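(* Let $S$ be a commutative monoid such that $R\neq\emptyset$, and suppose that the class $\mathfrak{R}$ of all regular $S$-acts is axiomatizable. Then the following conditions are equivalent: (1) the class $\mathfrak{R}$ is primitive normal; (2) the class $\mathfrak{R}$ is antiadditive; (3) the semigroup $R$ is linearly ordered.
   Context: **$S$-acts.** $S$ is a monoid with identity $1$. A (left) $S$-act ${}_SA$ is a structure $\langle A;s\rangle_{s\in S}$ in the first-order language (with equality) $L_S=\{s\mid s\in S\}$ of unary function symbols such that $s_1(s_2a)=(s_1s_2)a$ and $1a=a$ for all $s_1,s_2\in S$, $a\in A$. ${}_SS$ is $S$ acting on itself by left multiplication. For $a\in A$, ${}_SSa$ is the subact generated by $a$. An element $a\in A$ is act-regular if there is a homomorphism of $S$-acts $\varphi:{}_SSa\to{}_SS$ with $\varphi(a)a=a$. An $S$-act is regular if all its elements are act-regular. ${}_SR$ (with underlying set $R$) denotes the union of all regular subacts of ${}_SS$; it is the largest regular subact of ${}_SS$, a left ideal of $S$, and hence a semigroup under the multiplication of $S$. A semigroup $T$ is linearly ordered if for all $a,b\in T$ either $Ta\subseteq Tb$ or $Tb\subseteq Ta$. A class of $L_S$-structures is axiomatizable if it is the class of all models of some set of first-order sentences of $L_S$. **Primitive normality.** A primitive formula is a formula $\exists\bar x(\Phi_0\wedge\cdots\wedge\Phi_k)$ with all $\Phi_i$ atomic. Let $\mathcal{C}$ be a large, sufficiently saturated model of a complete theory $T$. For a primitive formula $\Phi(\bar x,\bar y)$ and tuples $\bar a,\bar b$ in $\mathcal{C}$ with $|\bar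 a|=|\bar b|=|\bar y|$, the set $\Phi(\mathcal{C},\bar a)=\{\bar c\mid\mathcal{C}\models\Phi(\bar c,\bar a)\}$ is called a primitive set, and $\Phi(\mathcal{C},\bar a)$, $\Phi(\mathcal{C},\bar b)$ are called primitive copies. $T$ is primitive normal if for any primitive copies $X,Y$ either $X=Y$ or $X\cap Y=\varnothing$. **Antiadditivity.** A primitive equivalence is an equivalence relation $\alpha$ on a set $X$ of $n$-tuples of elements of $\mathcal{C}$ that is defined in $\mathcal{C}$ by a primitive formula $\Phi(\bar x_1,\bar x_2)$; its domain $dom(\alpha)=X$ is defined by $\Phi(\bar x,\bar x)$, and $\bar a/\alpha$ is the $\alpha$-class of $\bar a$. A set is $\Delta$-primitive if it is the intersection of a family of primitive sets. A generalized primitive set is a set $X=X^*/\alpha=\{\bar a/\alpha\mid\bar a\in X^*\}$, where $X^*$ is $\Delta$-primitive, $\alpha$ is a primitive equivalence and $X^*\subseteq dom(\alpha)$. A primitive formula $\Phi(\bar x,\bar y,\bar z,\bar a)$ (with parameters $\bar a$ in $\mathcal{C}$) defines a binary operation $+$ on $X$ if for all $\bar b,\bar c,\bar d\in X^*$: $\bar b/\alpha+\bar c/\alpha=\bar d/\alpha$ if and only if $\mathcal{C}\models\Phi(\bar b,\bar c,\bar d,\bar a)$. $T$ is antiadditive if it is primitive normal and there is no infinite generalized primitive set that is an Abelian group under an operation defined by a primitive formula. **Classes.** An axiomatizable class of structures is primitive normal (respectively antiadditive) if the theory of the class (the set of sentences true in all its members) is. Since this theory need not be complete, this means that every completion of it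 is primitive normal (respectively antiadditive). *)

theory Defs
  imports Main "HOL-Library.Equipollence" "HOL-Algebra.Group"
begin

section \<open>First-order logic of the language of left acts\<close>

text \<open>
  The elements of the monoid are the unary function symbols of the language.  Terms and formulas
  are kept syntactic, over arbitrary structures; the act axioms are imposed only later.
\<close>

datatype 's trm = Var nat | App 's "'s trm"

datatype 's fm = Eq "'s trm" "'s trm" | Neg "'s fm" | Conj "'s fm" "'s fm" | Ex nat "'s fm"

record ('s, 'a) L_struct =
  univ :: "'a set"
  act :: "'s \<Rightarrow> 'a \<Rightarrow> 'a"

text \<open>As usual in first-order logic, structures are nonempty.\<close>

definition is_struct :: "('s, 'a) L_struct \<Rightarrow> bool" where
  "is_struct M \<longleftrightarrow> univ M \<noteq> {} \<and> (\<forall>s. \<forall>a \<in> univ M. act M s a \<in> univ M)"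

fun tvar :: "'s trm \<Rightarrow> nat" where
  "tvar (Var i) = i"
| "tvar (App s t) = tvar t"

fun fv :: "'s fm \<Rightarrow> nat set" where
  "fv (Eq t u) = {tvar t, tvar u}"
| "fv (Neg \<phi>) = fv \<phi>"
| "fv (Conj \<phi> \<psi>) = fv \<phi> \<union> fv \<psi>"
| "fv (Ex i \<phi>) = fv \<phi> - {i}"

fun tval :: "('s, 'a) L_struct \<Rightarrow> (nat \<Rightarrow> 'a) \<Rightarrow> 's trm \<Rightarrow> 'a" where
  "tval M e (Var i) = e i"
| "tval M e (App s t) = act M s (tval M e t)"

fun sat :: "('s, 'a) L_struct \<Rightarrow> (nat \<Rightarrow> 'a) \<Rightarrow> 's fm \<Rightarrow> bool" where
  "sat M e (Eq t u) \<longleftrightarrow> tval M e t = tval M e u"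
| "sat M e (Neg \<phi>) \<longleftrightarrow> \<not> sat M e \<phi>"
| "sat M e (Conj \<phi> \<psi>) \<longleftrightarrow> sat M e \<phi> \<and> sat M e \<psi>"
| "sat M e (Ex i \<phi>) \<longleftrightarrow> (\<exists>x \<in> univ M. sat M (e(i := x)) \<phi>)"

text \<open>
  A tuple is a list.  \<open>holds M \<phi> xs\<close> evaluates \<open>\<phi>\<close> with the \<open>i\<close>-th variable set to \<open>xs ! i\<close>; it is
  used only when the free variables of \<open>\<phi>\<close> are below \<open>length xs\<close>.  Thus a formula
  \<open>\<Phi>(x, y)\<close> in tuples of variables of lengths \<open>n\<close> and \<open>m\<close> is one with
  \<open>fv \<Phi> \<subseteq> {..<n + m}\<close>, and it is evaluated at \<open>c @ a\<close>.
\<close>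

definition holds :: "('s, 'a) L_struct \<Rightarrow> 's fm \<Rightarrow> 'a list \<Rightarrow> bool" where
  "holds M \<phi> xs \<longleftrightarrow> sat M (\<lambda>i. xs ! i) \<phi>"

definition tuples :: "('s, 'a) L_struct \<Rightarrow> nat \<Rightarrow> 'a list set" where
  "tuples M n = {c. length c = n \<and> set c \<subseteq> univ M}"

definition sentence :: "'s fm \<Rightarrow> bool" where
  "sentence \<phi> \<longleftrightarrow> fv \<phi> = {}"

definition is_model :: "('s, 'a) L_struct \<Rightarrow> 's fm set \<Rightarrow> bool" where
  "is_model M T \<longleftrightarrow> is_struct M \<and> (\<forall>\<phi> \<in> T. holds M \<phi> [])"

text \<open>
  A class of structures is represented by a set of structures with universes contained in a
  type \<open>'u\<close>.  Notions that quantify over models take \<open>'u\<close> as a parameter.  They agree with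
  the usual ones once \<open>'u\<close> has at least \<open>2\<^sup>\<lambda>\<close> elements, where \<open>\<lambda> = |S| + \<aleph>\<^sub>0\<close> is the number of
  formulas: by Loewenheim--Skolem (satisfiability; and axiomatizability of the class of
  regular acts, which is closed under subacts), and because every complete theory then has a
  \<open>\<lambda>\<close>-plus-saturated model with universe contained in \<open>'u\<close>.
\<close>

definition large_universe :: "'s itself \<Rightarrow> 'u itself \<Rightarrow> bool" where
  "large_universe _ _ \<longleftrightarrow> (UNIV :: ('s + nat) set set) \<lesssim> (UNIV :: 'u set)"

definition axiomatizable :: "('s, 'u) L_struct set \<Rightarrow> bool" where
  "axiomatizable K \<longleftrightarrow> (\<exists>\<Sigma>. (\<forall>\<phi> \<in> \<Sigma>. sentence \<phi>) \<and> K = {M. is_model M \<Sigma>})"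

definition theory_of :: "('s, 'u) L_struct set \<Rightarrow> 's fm set" where
  "theory_of K = {\<phi>. sentence \<phi> \<and> (\<forall>M \<in> K. holds M \<phi> [])}"

definition complete_theory :: "'u itself \<Rightarrow> 's fm set \<Rightarrow> bool" where
  "complete_theory _ T \<longleftrightarrow>
     (\<forall>\<phi> \<in> T. sentence \<phi>) \<and>
     (\<exists>M :: ('s, 'u) L_struct. is_model M T) \<and>
     (\<forall>\<phi>. sentence \<phi> \<longrightarrow> \<phi> \<in> T \<or> Neg \<phi> \<in> T)"

text \<open>
  Saturation for the successor of the cardinal \<open>\<lambda> = |S| + \<aleph>\<^sub>0\<close>: every finitely satisfiable
  1-type over a set of at most \<open>\<lambda>\<close> parameters is realized.  A member \<open>(\<phi>, bs)\<close> of \<open>p\<close> stands for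
  \<open>\<phi>(x, bs)\<close>.
\<close>

definition saturated :: "('s, 'a) L_struct \<Rightarrow> bool" where
  "saturated M \<longleftrightarrow>
     (\<forall>B p. B \<subseteq> univ M \<and> B \<lesssim> (UNIV :: ('s + nat) set) \<and>
        (\<forall>(\<phi>, bs) \<in> p. set bs \<subseteq> B \<and> fv \<phi> \<subseteq> {..<Suc (length bs)}) \<and>
        (\<forall>q. finite q \<and> q \<subseteq> p \<longrightarrow> (\<exists>c \<in> univ M. \<forall>(\<phi>, bs) \<in> q. holds M \<phi> (c # bs)))
        \<longrightarrow> (\<exists>c \<in> univ M. \<forall>(\<phi>, bs) \<in> p. holds M \<phi> (c # bs)))"

text \<open>
  The sufficiently saturated models of a complete theory.  Saturation above \<open>\<lambda>\<close> suffices to make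
  the properties below independent of the model: primitive normality is first-order, and
  under it a nonempty intersection of primitive sets involves at most one copy per formula,
  hence at most \<open>\<lambda>\<close> parameters.
\<close>

definition monster :: "'s fm set \<Rightarrow> ('s, 'a) L_struct \<Rightarrow> bool" where
  "monster T C \<longleftrightarrow> is_model C T \<and> saturated C"

section \<open>Primitive normality and antiadditivity\<close>

fun conj_of_atomic :: "'s fm \<Rightarrow> bool" where
  "conj_of_atomic (Eq t u) = True"
| "conj_of_atomic (Conj \<phi> \<psi>) = (conj_of_atomic \<phi> \<and> conj_of_atomic \<psi>)"
| "conj_of_atomic _ = False"

fun primitive :: "'s fm \<Rightarrow> bool" where
  "primitive (Ex i \<phi>) = primitive \<phi>"
| "primitive \<phi> = conj_of_atomic \<phi>"

definition def_set :: "('s, 'a) L_struct \<Rightarrow> nat \<Rightarrow> 's fm \<Rightarrow> 'a list \<Rightarrow> 'a list set" where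
  "def_set C n \<phi> a = {c \<in> tuples C n. holds C \<phi> (c @ a)}"

definition primitive_normal :: "'u itself \<Rightarrow> 's fm set \<Rightarrow> bool" where
  "primitive_normal _ T \<longleftrightarrow>
     (\<forall>C :: ('s, 'u) L_struct. monster T C \<longrightarrow>
       (\<forall>n m \<phi>. primitive \<phi> \<and> fv \<phi> \<subseteq> {..<n + m} \<longrightarrow>
         (\<forall>a \<in> tuples C m. \<forall>b \<in> tuples C m.
            def_set C n \<phi> a = def_set C n \<phi> b \<or> def_set C n \<phi> a \<inter> def_set C n \<phi> b = {})))"

definition primitive_set :: "('s, 'a) L_struct \<Rightarrow> nat \<Rightarrow> 'a list set \<Rightarrow> bool" where
  "primitive_set C n X \<longleftrightarrow>
     (\<exists>m \<phi> a. primitive \<phi> \<and> fv \<phi> \<subseteq> {..<n + m} \<and> a \<in> tuples C m \<and> X = def_set C n \<phi> a)"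

definition Delta_primitive_set :: "('s, 'a) L_struct \<Rightarrow> nat \<Rightarrow> 'a list set \<Rightarrow> bool" where
  "Delta_primitive_set C n X \<longleftrightarrow> (\<exists>F. F \<noteq> {} \<and> (\<forall>Y \<in> F. primitive_set C n Y) \<and> X = \<Inter>F)"

definition primitive_equivalence ::
    "('s, 'a) L_struct \<Rightarrow> nat \<Rightarrow> ('a list \<times> 'a list) set \<Rightarrow> bool" where
  "primitive_equivalence C n \<alpha> \<longleftrightarrow>
     (\<exists>\<phi>. primitive \<phi> \<and> fv \<phi> \<subseteq> {..<n + n} \<and>
        \<alpha> = {(b, c). b \<in> tuples C n \<and> c \<in> tuples C n \<and> holds C \<phi> (b @ c)}) \<and>
     equiv (Domain \<alpha>) \<alpha>"

text \<open>
  The generalized primitive set given by \<open>X\<close> (this is \<open>X\<^sup>*\<close> in the usual notation) and \<open>\<alpha>\<close> is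
  the quotient \<open>X // \<alpha>\<close>, whose elements are the full \<open>\<alpha>\<close>-classes of the members of \<open>X\<close>.
\<close>

definition gen_primitive_rep ::
    "('s, 'a) L_struct \<Rightarrow> nat \<Rightarrow> 'a list set \<Rightarrow> ('a list \<times> 'a list) set \<Rightarrow> bool" where
  "gen_primitive_rep C n X \<alpha> \<longleftrightarrow>
     Delta_primitive_set C n X \<and> primitive_equivalence C n \<alpha> \<and> X \<subseteq> Domain \<alpha>"

definition primitive_operation ::
    "('s, 'a) L_struct \<Rightarrow> nat \<Rightarrow> 'a list set \<Rightarrow> ('a list \<times> 'a list) set \<Rightarrow>
     ('a list set \<Rightarrow> 'a list set \<Rightarrow> 'a list set) \<Rightarrow> bool" where
  "primitive_operation C n X \<alpha> add \<longleftrightarrow>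
     (\<exists>m \<phi> a. primitive \<phi> \<and> fv \<phi> \<subseteq> {..<n + n + n + m} \<and> a \<in> tuples C m \<and>
        (\<forall>b \<in> X. \<forall>c \<in> X. \<forall>d \<in> X.
           add (\<alpha> `` {b}) (\<alpha> `` {c}) = \<alpha> `` {d} \<longleftrightarrow> holds C \<phi> (b @ c @ d @ a)))"

definition antiadditive :: "'u itself \<Rightarrow> 's fm set \<Rightarrow> bool" where
  "antiadditive U T \<longleftrightarrow>
     primitive_normal U T \<and>
     (\<forall>C :: ('s, 'u) L_struct. monster T C \<longrightarrow>
        \<not> (\<exists>n X \<alpha> add z.
             gen_primitive_rep C n X \<alpha> \<and> infinite (X // \<alpha>) \<and>
             primitive_operation C n X \<alpha> add \<and>
             comm_group \<lparr>carrier = X // \<alpha>, mult = add, one = z\<rparr>))"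

definition completion :: "'u itself \<Rightarrow> 's fm set \<Rightarrow> 's fm set \<Rightarrow> bool" where
  "completion U T\<^sub>0 T \<longleftrightarrow> complete_theory U T \<and> T\<^sub>0 \<subseteq> T"

definition class_primitive_normal :: "('s, 'u) L_struct set \<Rightarrow> bool" where
  "class_primitive_normal K \<longleftrightarrow>
     (\<forall>T. completion TYPE('u) (theory_of K) T \<longrightarrow> primitive_normal TYPE('u) T)"

definition class_antiadditive :: "('s, 'u) L_struct set \<Rightarrow> bool" where
  "class_antiadditive K \<longleftrightarrow>
     (\<forall>T. completion TYPE('u) (theory_of K) T \<longrightarrow> antiadditive TYPE('u) T)"

section \<open>Acts over a monoid\<close>

definition is_act :: "('s::monoid_mult, 'a) L_struct \<Rightarrow> bool" where
  "is_act A \<longleftrightarrow> is_struct A \<and>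
     (\<forall>a \<in> univ A. act A 1 a = a \<and> (\<forall>s t. act A s (act A t a) = act A (s * t) a))"

definition act_hom ::
    "('s, 'a) L_struct \<Rightarrow> ('s, 'b) L_struct \<Rightarrow> ('a \<Rightarrow> 'b) \<Rightarrow> bool" where
  "act_hom A B f \<longleftrightarrow>
     (\<forall>a \<in> univ A. f a \<in> univ B) \<and> (\<forall>s. \<forall>a \<in> univ A. f (act A s a) = act B s (f a))"

definition monoid_act :: "('s::monoid_mult, 's) L_struct" where
  "monoid_act = \<lparr>univ = UNIV, act = (*)\<rparr>"

definition cyclic_subact :: "('s, 'a) L_struct \<Rightarrow> 'a \<Rightarrow> ('s, 'a) L_struct" where
  "cyclic_subact A a = A\<lparr>univ := {act A s a | s. True}\<rparr>"

definition act_regular :: "('s::monoid_mult, 'a) L_struct \<Rightarrow> 'a \<Rightarrow> bool" where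
  "act_regular A a \<longleftrightarrow>
     (\<exists>\<phi>. act_hom (cyclic_subact A a) (monoid_act :: ('s, 's) L_struct) \<phi> \<and> act A (\<phi> a) a = a)"

definition regular_act :: "('s::monoid_mult, 'a) L_struct \<Rightarrow> bool" where
  "regular_act A \<longleftrightarrow> is_act A \<and> (\<forall>a \<in> univ A. act_regular A a)"

definition regular_acts :: "('s::monoid_mult, 'u) L_struct set" where
  "regular_acts = {A. regular_act A}"

text \<open>
  Every subset \<open>B\<close> of \<open>S\<close> for which the restriction of \<open>S\<close> to \<open>B\<close> is an act is automatically
  closed under the action, hence a subact.
\<close>

definition regular_part :: "'s::monoid_mult set" where
  "regular_part = \<Union>{B. regular_act ((monoid_act :: ('s, 's) L_struct)\<lparr>univ := B\<rparr>)}"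

definition linearly_ordered :: "'s::semigroup_mult set \<Rightarrow> bool" where
  "linearly_ordered T \<longleftrightarrow>
     (\<forall>a \<in> T. \<forall>b \<in> T. (\<lambda>t. t * a) ` T \<subseteq> (\<lambda>t. t * b) ` T \<or> (\<lambda>t. t * b) ` T \<subseteq> (\<lambda>t. t * a) ` T)"

end

theory Submission
  imports Defs "HOL-Algebra.Free_Abelian_Groups"
begin

text \<open>
  Over a commutative monoid, an element \<open>a\<close> of a regular act has a unique idempotent \<open>e\<close> in \<open>R\<close>
  with \<open>s a = t a \<longleftrightarrow> s e = t e\<close>, so the cyclic subact of \<open>a\<close> is a copy of \<open>S e\<close>.  Questions
  about regular acts thus become questions about divisibility inside \<open>R\<close>.

  Suppose that \<open>R\<close> is linearly ordered.  Axiomatizability makes every model of the theory of the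
  class a regular act.  On such an act \<open>A\<close> put \<open>p(x, y, z) = z\<close> if every \<open>s\<close> that identifies \<open>y\<close>
  with \<open>z\<close> also identifies \<open>y\<close> with \<open>x\<close>, and \<open>p(x, y, z) = x\<close> otherwise.  Because any two
  multiples of \<open>x, y, z\<close> are comparable, \<open>p\<close> is a homomorphism from \<open>A\<^sup>3\<close> to \<open>A\<close>
  (lemma \<open>pixley_hom\<close>), so all primitive relations are closed under it, and it is a Pixley
  operation: \<open>p(x, x, y) = p(y, x, x) = p(y, x, y) = y\<close>.  The first two identities turn three of
  the four memberships between two intersecting primitive copies into the fourth, which is
  primitive normality.  All three together collapse every Abelian group with a primitive graph:
  applied to \<open>0 + x = x\<close>, \<open>x + 0 = x\<close> and \<open>0 + 0 = 0\<close> they give \<open>0 + x = 0\<close>.  So there is not even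
  a nontrivial primitive group, and the theory is antiadditive.

  Conversely, let \<open>a, b\<close> in \<open>R\<close> be incomparable.  The formula \<open>\<exists>z. a z = x \<and> b z = y\<close> violates
  primitive normality in every act with elements \<open>p, q, r\<close> such that \<open>a p = a q\<close>, \<open>b p = b r\<close>
  and no \<open>z\<close> has \<open>a z = a r\<close>, \<open>b z = b q\<close>.  If a single idempotent \<open>g\<close> in \<open>R\<close> fixes \<open>a\<close> and \<open>b\<close>,
  such an act arises by gluing three copies of \<open>S g\<close>, the second to the first along \<open>S a\<close> and the
  third to the first along \<open>S b\<close>.  Otherwise the idempotents \<open>e, g\<close> of \<open>a, b\<close> are
  incomparable, and the subact \<open>S e \<union> S g\<close> of \<open>S\<close> serves, with \<open>e, g\<close> in place of \<open>a, b\<close>.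

  Primitive normality speaks only about saturated models, so the violation, which is
  expressed by one sentence, has to be carried into a saturated elementarily equivalent
  model with at most \<open>2\<^sup>\<lambda>\<close> elements, where \<open>\<lambda> = |S| + \<aleph>\<^sub>0\<close>.  It is built in one step, by a Henkin
  construction whose constants are well-founded trees: each type over at most \<open>\<lambda>\<close> constants has a
  constant of its own, which realizes the type whenever the type is consistent with the
  diagram (lemmas \<open>realizing_ultrafilter\<close> and \<open>saturated_elementarily_equivalent\<close>).
\<close>

section \<open>Evaluation of terms and formulas\<close>

lemma tval_cong: "e (tvar t) = e' (tvar t) \<Longrightarrow> tval M e t = tval M e' t"
  by (induction t) auto

lemma sat_cong: "(\<And>i. i \<in> fv \<phi> \<Longrightarrow> e i = e' i) \<Longrightarrow> sat M e \<phi> = sat M e' \<phi>"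
proof (induction \<phi> arbitrary: e e')
  case (Eq t u)
  then show ?case using tval_cong[of e t e' M] tval_cong[of e u e' M] by simp
next
  case (Neg \<phi>)
  then show ?case by (metis fv.simps(2) sat.simps(2))
next
  case (Conj \<phi> \<psi>)
  have "sat M e \<phi> = sat M e' \<phi>" "sat M e \<psi> = sat M e' \<psi>"
    by (auto intro!: Conj.IH Conj.prems)
  then show ?case by simp
next
  case (Ex i \<phi>)
  have "sat M (e(i := x)) \<phi> = sat M (e'(i := x)) \<phi>" for x
    using Ex.prems by (intro Ex.IH) auto
  then show ?case by simp
qed

lemma finite_fv: "finite (fv \<phi>)"
  by (induction \<phi>) auto

lemma holds_sentence: "sentence \<phi> \<Longrightarrow> holds M \<phi> [] = sat M e \<phi>"
  unfolding holds_def sentence_def by (rule sat_cong) simp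

lemma tval_in_univ: "is_struct M \<Longrightarrow> e (tvar t) \<in> univ M \<Longrightarrow> tval M e t \<in> univ M"
  by (induction t) (auto simp: is_struct_def)

lemma sat_isomorphic:
  assumes M: "is_struct M" and inj: "inj_on f (univ M)" and univ: "univ N = f ` univ M"
    and act: "\<And>s x. x \<in> univ M \<Longrightarrow> act N s (f x) = f (act M s x)"
  shows "(\<And>i. i \<in> fv \<phi> \<Longrightarrow> e i \<in> univ M) \<Longrightarrow> sat N (f \<circ> e) \<phi> = sat M e \<phi>"
proof (induction \<phi> arbitrary: e)
  case (Eq t u)
  have *: "tval N (f \<circ> e) t = f (tval M e t)" if "e (tvar t) \<in> univ M" for t
    using that
  proof (induction t)
    case (App s t)
    then show ?case using tval_in_univ[OF M, of e t] act by simp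
  qed simp
  have "e (tvar t) \<in> univ M" "e (tvar u) \<in> univ M"
    using Eq by auto
  then show ?case
    using inj_on_eq_iff[OF inj, of "tval M e t" "tval M e u"] tval_in_univ[OF M]
    by (simp only: sat.simps *)
next
  case (Ex i \<phi>)
  have "sat N ((f \<circ> e)(i := f x)) \<phi> = sat M (e(i := x)) \<phi>" if "x \<in> univ M" for x
  proof -
    have "sat N (f \<circ> e(i := x)) \<phi> = sat M (e(i := x)) \<phi>"
      using Ex.prems that by (intro Ex.IH) auto
    then show ?thesis by (simp only: fun_upd_comp)
  qed
  then show ?case unfolding sat.simps univ by (blast dest: iffD1 iffD2)
qed auto

text \<open>
  Homomorphisms from a power of a structure preserve primitive formulas coordinatewise; the
  image of three witnesses is a witness.
\<close>

lemma sat_ternary_polymorphism: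
  assumes closed: "\<And>x y z. \<lbrakk>x \<in> univ M; y \<in> univ M; z \<in> univ M\<rbrakk> \<Longrightarrow> f x y z \<in> univ M"
    and hom: "\<And>s x y z. \<lbrakk>x \<in> univ M; y \<in> univ M; z \<in> univ M\<rbrakk> \<Longrightarrow>
      f (act M s x) (act M s y) (act M s z) = act M s (f x y z)"
    and M: "is_struct M"
  shows "\<lbrakk>primitive \<phi>; \<And>i. i \<in> fv \<phi> \<Longrightarrow> e i \<in> univ M \<and> e' i \<in> univ M \<and> e'' i \<in> univ M;
    sat M e \<phi>; sat M e' \<phi>; sat M e'' \<phi>\<rbrakk> \<Longrightarrow> sat M (\<lambda>i. f (e i) (e' i) (e'' i)) \<phi>"
proof (induction \<phi> arbitrary: e e' e'')
  case (Eq t u)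
  have "tval M (\<lambda>i. f (e i) (e' i) (e'' i)) t = f (tval M e t) (tval M e' t) (tval M e'' t)"
    if "e (tvar t) \<in> univ M" "e' (tvar t) \<in> univ M" "e'' (tvar t) \<in> univ M" for t
    using that by (induction t) (simp_all add: hom tval_in_univ[OF M])
  then show ?case using Eq by simp
next
  case (Conj \<phi> \<psi>)
  have "primitive \<phi>" "primitive \<psi>"
    using Conj.prems(1) by (cases \<phi>; cases \<psi>; simp)+
  moreover have "sat M e \<phi>" "sat M e' \<phi>" "sat M e'' \<phi>" "sat M e \<psi>" "sat M e' \<psi>" "sat M e'' \<psi>"
    using Conj.prems by auto
  ultimately show ?case using Conj.IH Conj.prems(2) by simp
next
  case (Ex i \<phi>)
  obtain x y z where xyz: "x \<in> univ M" "y \<in> univ M" "z \<in> univ M" "sat M (e(i := x)) \<phi>"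
      "sat M (e'(i := y)) \<phi>" "sat M (e''(i := z)) \<phi>"
    using Ex.prems by auto
  have "(e(i := x)) j \<in> univ M \<and> (e'(i := y)) j \<in> univ M \<and> (e''(i := z)) j \<in> univ M"
    if "j \<in> fv \<phi>" for j
    using Ex.prems(2)[of j] that xyz by (cases "j = i") auto
  moreover have "primitive \<phi>"
    using Ex.prems(1) by simp
  ultimately have "sat M (\<lambda>j. f ((e(i := x)) j) ((e'(i := y)) j) ((e''(i := z)) j)) \<phi>"
    using xyz by (intro Ex.IH)
  moreover have "(\<lambda>j. f ((e(i := x)) j) ((e'(i := y)) j) ((e''(i := z)) j)) =
      (\<lambda>j. f (e j) (e' j) (e'' j))(i := f x y z)"
    by (rule ext) simp
  ultimately have "sat M ((\<lambda>j. f (e j) (e' j) (e'' j))(i := f x y z)) \<phi>"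
    by (simp only:)
  then show ?case
    unfolding sat.simps using closed[OF xyz(1-3)] by blast
qed simp

section \<open>Regular acts over a commutative monoid\<close>

text \<open>
  The idempotent \<open>e\<close> is the image of \<open>a\<close> under the homomorphism of the definition of
  act-regularity, and it determines that homomorphism as \<open>s a \<mapsto> s e\<close>.
\<close>

lemma act_regular_iff:
  fixes A :: "('s::monoid_mult, 'a) L_struct"
  assumes A: "is_act A" and a: "a \<in> univ A"
  shows "act_regular A a \<longleftrightarrow>
    (\<exists>e. e * e = e \<and> act A e a = a \<and> (\<forall>s t. act A s a = act A t a \<longrightarrow> s * e = t * e))"
proof
  assume "act_regular A a"
  then obtain \<phi> where hom: "act_hom (cyclic_subact A a) (monoid_act :: ('s, 's) L_struct) \<phi>"
      and idem: "act A (\<phi> a) a = a"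
    unfolding act_regular_def by blast
  have one: "act A 1 a = a"
    using A a unfolding is_act_def by auto
  have "\<phi> (act A s (act A 1 a)) = s * \<phi> (act A 1 a)" for s
    using hom unfolding act_hom_def cyclic_subact_def monoid_act_def by auto
  then have "\<phi> (act A s a) = s * \<phi> a" for s
    by (simp add: one)
  then show "\<exists>e. e * e = e \<and> act A e a = a \<and> (\<forall>s t. act A s a = act A t a \<longrightarrow> s * e = t * e)"
    using idem by metis
next
  assume "\<exists>e. e * e = e \<and> act A e a = a \<and> (\<forall>s t. act A s a = act A t a \<longrightarrow> s * e = t * e)"
  then obtain e where e: "e * e = e" "act A e a = a"
      and eq: "\<And>s t. act A s a = act A t a \<Longrightarrow> s * e = t * e"
    by blast
  define \<phi> where "\<phi> x = (SOME s. x = act A s a) * e" for x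
  have \<phi>: "\<phi> (act A s a) = s * e" for s
    unfolding \<phi>_def by (rule eq[symmetric]) (rule someI[where x = s], rule refl)
  have one: "act A 1 a = a" and assoc: "act A s (act A t a) = act A (s * t) a" for s t
    using A a unfolding is_act_def by auto
  have "\<phi> a = e"
    using \<phi>[of e] e by simp
  moreover have "act_hom (cyclic_subact A a) (monoid_act :: ('s, 's) L_struct) \<phi>"
    unfolding act_hom_def cyclic_subact_def monoid_act_def
    by (auto simp: \<phi> assoc mult.assoc)
  ultimately show "act_regular A a"
    unfolding act_regular_def using e by blast
qed

lemma is_act_monoid_act: "is_act (monoid_act :: ('s::monoid_mult, 's) L_struct)"
  unfolding is_act_def is_struct_def monoid_act_def by (simp add: mult.assoc)

lemma act_regular_monoid_act_iff:
  fixes a :: "'s::monoid_mult"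
  shows "act_regular monoid_act a \<longleftrightarrow>
    (\<exists>e. e * e = e \<and> e * a = a \<and> (\<forall>s t. s * a = t * a \<longrightarrow> s * e = t * e))"
  using act_regular_iff[OF is_act_monoid_act, of a] by (simp add: monoid_act_def)

lemma regular_act_monoid_subset_iff:
  "regular_act ((monoid_act :: ('s::monoid_mult, 's) L_struct)\<lparr>univ := B\<rparr>) \<longleftrightarrow>
    B \<noteq> {} \<and> (\<forall>s. \<forall>b \<in> B. s * b \<in> B) \<and> (\<forall>b \<in> B. act_regular monoid_act b)"
  unfolding regular_act_def is_act_def is_struct_def act_regular_def cyclic_subact_def monoid_act_def
  by (auto simp: mult.assoc)

text \<open>
  Regular subacts are unions of cyclic ones, so membership in the largest regular subact can be
  tested on the left ideal generated by the element.
\<close>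

lemma regular_part_iff:
  fixes a :: "'s::monoid_mult"
  shows "a \<in> regular_part \<longleftrightarrow> (\<forall>s. act_regular monoid_act (s * a))"
proof
  assume "a \<in> regular_part"
  then show "\<forall>s. act_regular monoid_act (s * a)"
    unfolding regular_part_def by (auto simp: regular_act_monoid_subset_iff)
next
  assume reg: "\<forall>s. act_regular monoid_act (s * a)"
  have "a \<in> range (\<lambda>s. s * a)"
    by (rule range_eqI[of _ _ 1]) simp
  moreover have "regular_act ((monoid_act :: ('s, 's) L_struct)\<lparr>univ := range (\<lambda>s. s * a)\<rparr>)"
    using reg by (auto simp: regular_act_monoid_subset_iff mult.assoc[symmetric])
  ultimately show "a \<in> regular_part"
    unfolding regular_part_def by blast
qed

lemma regular_part_left_ideal:
  fixes a :: "'s::monoid_mult"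
  shows "a \<in> regular_part \<Longrightarrow> s * a \<in> regular_part"
  by (simp add: regular_part_iff mult.assoc[symmetric])

text \<open>
  The idempotent attached to a regular element lies in the regular part: the cyclic
  subact \<open>S a\<close> is isomorphic to \<open>S e\<close>, which therefore is regular too.
\<close>

lemma regular_act_idempotent:
  fixes A :: "('s::comm_monoid_mult, 'a) L_struct"
  assumes A: "regular_act A" and a: "a \<in> univ A"
  obtains e where "e \<in> regular_part" "e * e = e" "act A e a = a"
    "\<And>s t. act A s a = act A t a \<longleftrightarrow> s * e = t * e"
proof -
  have act: "is_act A" and reg: "\<And>x. x \<in> univ A \<Longrightarrow> act_regular A x"
    using A unfolding regular_act_def by auto
  have assoc: "act A s (act A t a) = act A (s * t) a" for s t
    using act a unfolding is_act_def by auto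
  obtain e where e: "e * e = e" "act A e a = a"
      and eq: "\<And>s t. act A s a = act A t a \<Longrightarrow> s * e = t * e"
    using reg[OF a] act_regular_iff[OF act a] by blast
  have iff: "act A s a = act A t a \<longleftrightarrow> s * e = t * e" for s t
    using eq assoc e by metis
  have "act_regular monoid_act (s * e)" for s
  proof -
    have sa: "act A s a \<in> univ A"
      using act a unfolding is_act_def is_struct_def by auto
    have act_iff: "act A u (act A s a) = act A v (act A s a) \<longleftrightarrow> u * (s * e) = v * (s * e)" for u v
      using iff[of "u * s" "v * s"] by (simp add: assoc mult.assoc)
    have "act A u (act A s a) = act A s a \<longleftrightarrow> u * (s * e) = s * e" for u
      using iff[of "u * s" s] by (simp add: assoc mult.assoc)
    then show ?thesis
      using reg[OF sa] unfolding act_regular_monoid_act_iff act_regular_iff[OF act sa] act_iff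
      by simp
  qed
  then show ?thesis
    using that e iff regular_part_iff by blast
qed

lemma regular_part_idempotent:
  fixes a :: "'s::comm_monoid_mult"
  assumes "a \<in> regular_part"
  obtains e where "e \<in> regular_part" "e * e = e" "e * a = a"
proof -
  obtain B where B: "regular_act ((monoid_act :: ('s, 's) L_struct)\<lparr>univ := B\<rparr>)" "a \<in> B"
    using assms unfolding regular_part_def by blast
  show ?thesis
  proof (rule regular_act_idempotent[OF B(1)])
    show "a \<in> univ (monoid_act\<lparr>univ := B\<rparr>)"
      using B(2) by simp
    fix e :: 's
    assume "e \<in> regular_part" "e * e = e" "act (monoid_act\<lparr>univ := B\<rparr>) e a = a"
    then show thesis
      using that[of e] by (simp add: monoid_act_def)
  qed
qed

section \<open>Comparable multiples and the Pixley operation\<close>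

text \<open>
  An element \<open>a\<close> of the regular part \<open>R\<close> is a multiple \<open>e a\<close> of itself with \<open>e\<close> in \<open>R\<close>, so the inclusion
  of \<open>R a\<close> in \<open>R b\<close> already yields divisibility.
\<close>

lemma linearly_ordered_dvd:
  fixes a b :: "'s::comm_monoid_mult"
  assumes lin: "linearly_ordered (regular_part :: 's set)" and ab: "a \<in> regular_part" "b \<in> regular_part"
  shows "a dvd b \<or> b dvd a"
proof -
  have *: "b dvd a" if a: "a \<in> regular_part" and sub: "(\<lambda>t. t * a) ` regular_part \<subseteq> (\<lambda>t. t * b) ` regular_part"
    for a b :: 's
  proof -
    obtain e where "e \<in> regular_part" "e * a = a"
      using regular_part_idempotent[OF a] by metis
    then have "a \<in> (\<lambda>t. t * a) ` regular_part"
      by (metis image_eqI)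
    then have "a \<in> (\<lambda>t. t * b) ` regular_part"
      using sub by (rule rev_subsetD)
    then obtain t where "a = t * b" by (rule imageE)
    then show ?thesis by (rule dvdI[OF trans[OF _ mult.commute]])
  qed
  show ?thesis
    using lin[unfolded linearly_ordered_def, rule_format, OF ab] *[OF ab(1)] *[OF ab(2)] by blast
qed

text \<open>
  In a chain of idempotents the largest one fixes whatever the others fix.
\<close>

lemma common_idempotent:
  fixes A :: "('s::comm_monoid_mult, 'a) L_struct"
  assumes lin: "linearly_ordered (regular_part :: 's set)" and A: "regular_act A"
    and X: "finite X" "X \<noteq> {}" "X \<subseteq> univ A"
  shows "\<exists>e \<in> regular_part. e * e = e \<and> (\<forall>x \<in> X. act A e x = x)"
  using X
proof (induction X rule: finite_ne_induct)
  case (singleton x)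
  then have "x \<in> univ A" by simp
  then show ?case by (rule regular_act_idempotent[OF A]) auto
next
  case (insert x X)
  have assoc: "act A s (act A t y) = act A (s * t) y" if "y \<in> univ A" for s t y
    using A that unfolding regular_act_def is_act_def by auto
  obtain e where e: "e \<in> regular_part" "e * e = e" "\<And>y. y \<in> X \<Longrightarrow> act A e y = y"
    using insert by auto
  obtain f where f: "f \<in> regular_part" "f * f = f" "act A f x = x"
    using regular_act_idempotent[OF A, of x] insert.prems by (metis insert_subset)
  consider u where "f = e * u" | u where "e = f * u"
    using linearly_ordered_dvd[OF lin e(1) f(1)] by (auto elim: dvdE)
  then show ?case
  proof cases
    case (1 u)
    then have "e * f = f" using e(2) by (simp add: mult.assoc[symmetric])
    then have "act A e x = x" using assoc[of x e f] f insert.prems by simp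
    then show ?thesis using e by auto
  next
    case (2 u)
    then have "f * e = e" using f(2) by (simp add: mult.assoc[symmetric])
    then have "act A f y = y" if "y \<in> X" for y
      using assoc[of y f e] e(3)[OF that] insert.prems that by auto
    then show ?thesis using f by auto
  qed
qed

text \<open>
  On a finite set fixed by an idempotent \<open>e\<close> of the regular part, \<open>s\<close> and \<open>t\<close> act like \<open>s e\<close> and \<open>t e\<close>.
  These lie in the regular part and hence divide one another.  That one multiplier \<open>u\<close>
  works for all elements of the set at once is what makes the operation below a homomorphism.
\<close>

lemma comparable_multiples:
  fixes A :: "('s::comm_monoid_mult, 'a) L_struct"
  assumes lin: "linearly_ordered (regular_part :: 's set)" and A: "regular_act A"
    and X: "finite X" "X \<subseteq> univ A"
  shows "(\<exists>u. \<forall>x \<in> X. act A s x = act A u (act A t x)) \<or> (\<exists>u. \<forall>x \<in> X. act A t x = act A u (act A s x))"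
proof (cases "X = {}")
  case False
  have assoc: "act A s (act A t y) = act A (s * t) y" if "y \<in> X" for s t y
    using A that X unfolding regular_act_def is_act_def by auto
  obtain e where e: "e \<in> regular_part" "e * e = e" and unit: "\<And>x. x \<in> X \<Longrightarrow> act A e x = x"
    using common_idempotent[OF lin A X(1) False X(2)] by blast
  have *: "act A s x = act A (s * e) x" if "x \<in> X" for s x
    using assoc[OF that, of s e] unit[OF that] by simp
  have "s * e dvd t * e \<or> t * e dvd s * e"
    using linearly_ordered_dvd[OF lin] e regular_part_left_ideal by blast
  then show ?thesis
  proof
    assume "s * e dvd t * e"
    then obtain u where "t * e = s * e * u" by (auto elim: dvdE)
    then have "t * e = u * (s * e)" by (simp add: mult.commute)
    then have "\<forall>x \<in> X. act A t x = act A u (act A s x)"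
      using *[of _ t] *[of _ s] assoc[of _ u "s * e"] by metis
    then show ?thesis by blast
  next
    assume "t * e dvd s * e"
    then obtain u where "s * e = t * e * u" by (auto elim: dvdE)
    then have "s * e = u * (t * e)" by (simp add: mult.commute)
    then have "\<forall>x \<in> X. act A s x = act A u (act A t x)"
      using *[of _ t] *[of _ s] assoc[of _ u "t * e"] by metis
    then show ?thesis by blast
  qed
qed simp

definition agreement :: "('s, 'a) L_struct \<Rightarrow> 'a \<Rightarrow> 'a \<Rightarrow> 's set" where
  "agreement A x y = {s. act A s x = act A s y}"

text \<open>
  In a regular act over a linearly ordered regular part, any two agreement ideals with \<open>y\<close> are
  comparable.  The operation returns whichever
  outer argument coincides with \<open>y\<close> under fewer elements of the monoid, and \<open>z\<close> in case of a tie.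
\<close>

definition pixley :: "('s, 'a) L_struct \<Rightarrow> 'a \<Rightarrow> 'a \<Rightarrow> 'a \<Rightarrow> 'a" where
  "pixley A x y z = (if agreement A y z \<subseteq> agreement A y x then z else x)"

lemma pixley_identities:
  assumes "is_act A" "x \<in> univ A" "y \<in> univ A"
  shows "pixley A x x y = y" "pixley A y x x = y" "pixley A y x y = y"
proof -
  show "pixley A x x y = y" "pixley A y x y = y"
    unfolding pixley_def agreement_def by auto
  have one: "act A 1 x = x" "act A 1 y = y"
    using assms unfolding is_act_def by blast+
  have "x = y" if "agreement A x y = UNIV"
  proof -
    have "1 \<in> agreement A x y"
      using that by simp
    then show ?thesis
      unfolding agreement_def mem_Collect_eq one .
  qed
  then show "pixley A y x x = y"
    unfolding pixley_def by (auto simp: agreement_def[of A x x])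
qed

text \<open>
  Acting by \<open>s\<close> preserves inclusions of agreement ideals.  The only danger is that a proper
  inclusion becomes an equality, so that the operation switches from \<open>s x\<close> to \<open>s z\<close>.  Let \<open>v\<close> witness
  that the inclusion was proper.  If \<open>v\<close> factors through \<open>s\<close>, the inclusion stays
  proper.  If \<open>s\<close> factors through \<open>v\<close>, then \<open>s\<close> identifies \<open>y\<close> with \<open>z\<close>, hence by the
  equality also with \<open>x\<close>, and the switch is harmless.
\<close>

lemma pixley_hom:
  fixes A :: "('s::comm_monoid_mult, 'a) L_struct"
  assumes lin: "linearly_ordered (regular_part :: 's set)" and A: "regular_act A"
    and xyz: "x \<in> univ A" "y \<in> univ A" "z \<in> univ A"
  shows "pixley A (act A s x) (act A s y) (act A s z) = act A s (pixley A x y z)"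
proof -
  have assoc: "act A s (act A t w) = act A (s * t) w" if "w \<in> univ A" for s t w
    using A that unfolding regular_act_def is_act_def by auto
  have shift: "t \<in> agreement A (act A s v) (act A s w) \<longleftrightarrow> t * s \<in> agreement A v w"
    if "v \<in> univ A" "w \<in> univ A" for t v w
    using that unfolding agreement_def by (simp add: assoc)
  show ?thesis
  proof (cases "agreement A y z \<subseteq> agreement A y x")
    case True
    then have "agreement A (act A s y) (act A s z) \<subseteq> agreement A (act A s y) (act A s x)"
      using shift xyz by blast
    then show ?thesis using True unfolding pixley_def by simp
  next
    case False
    then obtain v where v: "act A v y = act A v z" "act A v y \<noteq> act A v x"
      unfolding agreement_def by blast
    have "act A s x = act A s z"
      if sub: "agreement A (act A s y) (act A s z) \<subseteq> agreement A (act A s y) (act A s x)"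
    proof -
      consider u where "\<forall>w \<in> {y, x, z}. act A v w = act A u (act A s w)"
        | u where "\<forall>w \<in> {y, x, z}. act A s w = act A u (act A v w)"
        using comparable_multiples[OF lin A, of "{y, x, z}" v s] xyz by auto
      then show ?thesis
      proof cases
        case (1 u)
        then have u: "act A v y = act A u (act A s y)" "act A v x = act A u (act A s x)"
            "act A v z = act A u (act A s z)"
          by auto
        have "u \<in> agreement A (act A s y) (act A s z)"
          using v(1) unfolding agreement_def mem_Collect_eq u .
        with sub have "u \<in> agreement A (act A s y) (act A s x)" by blast
        then have "act A v y = act A v x" unfolding agreement_def mem_Collect_eq u .
        with v show ?thesis by simp
      next
        case (2 u)
        then have "act A s y = act A s z" using v(1) by (metis insertI1 insertI2)
        then have "1 \<in> agreement A (act A s y) (act A s z)" unfolding agreement_def by simp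
        with sub have "1 \<in> agreement A (act A s y) (act A s x)" by blast
        then have "act A s y = act A s x"
          using xyz assoc[of y 1 s] assoc[of x 1 s] unfolding agreement_def by simp
        with \<open>act A s y = act A s z\<close> show ?thesis by simp
      qed
    qed
    with False show ?thesis unfolding pixley_def by auto
  qed
qed

lemma holds_pixley:
  fixes A :: "('s::comm_monoid_mult, 'a) L_struct"
  assumes lin: "linearly_ordered (regular_part :: 's set)" and A: "regular_act A"
    and \<phi>: "primitive \<phi>" "fv \<phi> \<subseteq> {..<n}"
    and len: "length xs = n" "length ys = n" "length zs = n" "length ws = n"
    and sub: "set xs \<subseteq> univ A" "set ys \<subseteq> univ A" "set zs \<subseteq> univ A"
    and holds: "holds A \<phi> xs" "holds A \<phi> ys" "holds A \<phi> zs"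
    and ws: "\<And>i. i < n \<Longrightarrow> ws ! i = pixley A (xs ! i) (ys ! i) (zs ! i)"
  shows "holds A \<phi> ws"
proof -
  have "sat A (\<lambda>i. pixley A (xs ! i) (ys ! i) (zs ! i)) \<phi>"
  proof (rule sat_ternary_polymorphism[where f = "pixley A" and
        e = "(!) xs" and e' = "(!) ys" and e'' = "(!) zs"])
    show "pixley A (act A s x) (act A s y) (act A s z) = act A s (pixley A x y z)"
      if "x \<in> univ A" "y \<in> univ A" "z \<in> univ A" for s x y z
      using pixley_hom[OF lin A that] .
    show "pixley A x y z \<in> univ A" if "x \<in> univ A" "y \<in> univ A" "z \<in> univ A" for x y z
      using that unfolding pixley_def by simp
    show "is_struct A" using A unfolding regular_act_def is_act_def by simp
    show "xs ! i \<in> univ A \<and> ys ! i \<in> univ A \<and> zs ! i \<in> univ A" if "i \<in> fv \<phi>" for i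
      using that \<phi> len sub by (auto intro!: subsetD[OF _ nth_mem])
  qed (use \<phi> holds in \<open>auto simp: holds_def\<close>)
  moreover have "sat A ((!) ws) \<phi> = sat A (\<lambda>i. pixley A (xs ! i) (ys ! i) (zs ! i)) \<phi>"
    using ws \<phi>(2) by (intro sat_cong) blast
  ultimately show ?thesis
    unfolding holds_def by simp
qed

text \<open>
  If \<open>c\<close> lies in both copies and \<open>d\<close> in the first, the Pixley identities map the tuples
  \<open>(c, b)\<close>, \<open>(c, a)\<close>, \<open>(d, a)\<close> of the primitive relation to \<open>(d, b)\<close>.
\<close>

lemma regular_act_primitive_normal:
  fixes A :: "('s::comm_monoid_mult, 'a) L_struct"
  assumes lin: "linearly_ordered (regular_part :: 's set)" and A: "regular_act A"
    and \<phi>: "primitive \<phi>" "fv \<phi> \<subseteq> {..<n + m}" and ab: "a \<in> tuples A m" "b \<in> tuples A m"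
  shows "def_set A n \<phi> a = def_set A n \<phi> b \<or> def_set A n \<phi> a \<inter> def_set A n \<phi> b = {}"
proof -
  have act: "is_act A" using A unfolding regular_act_def by simp
  have *: "def_set A n \<phi> a \<subseteq> def_set A n \<phi> b"
    if ab: "a \<in> tuples A m" "b \<in> tuples A m" and c: "c \<in> def_set A n \<phi> a" "c \<in> def_set A n \<phi> b"
    for a b c
  proof
    fix d assume d: "d \<in> def_set A n \<phi> a"
    have len: "length a = m" "length b = m" "length c = n" "length d = n"
      and sub: "set a \<subseteq> univ A" "set b \<subseteq> univ A" "set c \<subseteq> univ A" "set d \<subseteq> univ A"
      using ab c d unfolding def_set_def tuples_def by auto
    have "holds A \<phi> (d @ b)"
    proof (rule holds_pixley[OF lin A \<phi>])
      show "holds A \<phi> (c @ b)" "holds A \<phi> (c @ a)" "holds A \<phi> (d @ a)"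
        using c d unfolding def_set_def by auto
      show "(d @ b) ! i = pixley A ((c @ b) ! i) ((c @ a) ! i) ((d @ a) ! i)" if "i < n + m" for i
      proof (cases "i < n")
        case True
        then have "c ! i \<in> univ A" "d ! i \<in> univ A"
          using len sub by (auto intro!: subsetD[OF _ nth_mem])
        then show ?thesis using True len pixley_identities[OF act] by (simp add: nth_append)
      next
        case False
        then have "a ! (i - n) \<in> univ A" "b ! (i - n) \<in> univ A"
          using len sub that by (auto intro!: subsetD[OF _ nth_mem])
        then show ?thesis using False len pixley_identities[OF act] by (simp add: nth_append)
      qed
    qed (use len sub in auto)
    then show "d \<in> def_set A n \<phi> b" using d unfolding def_set_def by simp
  qed
  show ?thesis using *[OF ab] *[OF ab(2) ab(1)] by blast
qed

text \<open>
  With \<open>b\<close> representing \<open>x\<close> and \<open>c\<close> representing zero, the operation maps the triples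
  \<open>(c, b, b)\<close>, \<open>(b, c, b)\<close>, \<open>(c, c, c)\<close> of the graph of addition to \<open>(c, b, c)\<close>, that is, \<open>0 + x = 0\<close>.
  The coordinates are again \<open>b\<close> and \<open>c\<close>, so the result is an instance of the addition of classes.
\<close>

lemma regular_act_primitive_group_trivial:
  fixes A :: "('s::comm_monoid_mult, 'a) L_struct"
  assumes lin: "linearly_ordered (regular_part :: 's set)" and A: "regular_act A"
    and X: "X \<subseteq> tuples A n" and op: "primitive_operation A n X \<alpha> add"
    and G: "comm_group \<lparr>carrier = X // \<alpha>, mult = add, one = z\<rparr>"
  shows "X // \<alpha> = {z}"
proof -
  have act: "is_act A" using A unfolding regular_act_def by simp
  interpret G: comm_group "\<lparr>carrier = X // \<alpha>, mult = add, one = z\<rparr>" by (fact G)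
  obtain m \<phi> a where \<phi>: "primitive \<phi>" "fv \<phi> \<subseteq> {..<n + n + n + m}" and a: "a \<in> tuples A m"
    and add: "\<And>b c d. \<lbrakk>b \<in> X; c \<in> X; d \<in> X\<rbrakk> \<Longrightarrow>
      add (\<alpha> `` {b}) (\<alpha> `` {c}) = \<alpha> `` {d} \<longleftrightarrow> holds A \<phi> (b @ c @ d @ a)"
    using op unfolding primitive_operation_def by blast
  obtain c where c: "c \<in> X" "z = \<alpha> `` {c}"
    using G.one_closed by (auto elim: quotientE)
  have zero: "add z x = x" "add x z = x" if "x \<in> X // \<alpha>" for x
    using G.l_one[of x] G.r_one[of x] that by simp_all
  have "x = z" if x: "x \<in> X // \<alpha>" for x
  proof -
    obtain b where b: "b \<in> X" "x = \<alpha> `` {b}"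
      using x by (auto elim: quotientE)
    have len: "length a = m" "length b = n" "length c = n"
      and sub: "set a \<subseteq> univ A" "set b \<subseteq> univ A" "set c \<subseteq> univ A"
      using a b c X unfolding tuples_def by auto
    have "holds A \<phi> (c @ b @ c @ a)"
    proof (rule holds_pixley[OF lin A \<phi>])
      show "holds A \<phi> (c @ b @ b @ a)" "holds A \<phi> (b @ c @ b @ a)" "holds A \<phi> (c @ c @ c @ a)"
        using add[of b c b] add[of c b b] add[of c c c] b c zero[of x] zero[of z] x G.one_closed
        by auto
      fix i assume i: "i < n + n + n + m"
      have "b ! j \<in> univ A" "c ! j \<in> univ A" if "j < n" for j
        using len sub that by (auto intro!: subsetD[OF _ nth_mem])
      moreover have "a ! j \<in> univ A" if "j < m" for j
        using len sub that by (auto intro!: subsetD[OF _ nth_mem])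
      ultimately show "(c @ b @ c @ a) ! i =
          pixley A ((c @ b @ b @ a) ! i) ((b @ c @ b @ a) ! i) ((c @ c @ c @ a) ! i)"
        using i len by (auto simp: nth_append pixley_identities[OF act])
    qed (use len sub in auto)
    then have "add z x = z" using add[of c b c] b c by simp
    then show "x = z" using zero x by simp
  qed
  moreover have "z \<in> X // \<alpha>"
    using G.one_closed by simp
  ultimately show ?thesis by blast
qed

section \<open>Diagrams in which every consistent type is realized\<close>

text \<open>
  A constant \<open>Realizer P b\<close> is meant to realize the type \<open>P\<close> over the constants \<open>b k\<close>.  A member
  \<open>(\<phi>, i, ks)\<close> of \<open>P\<close> stands for \<open>\<phi>\<close> with the realized element in variable \<open>i\<close> and the parameter
  with index \<open>ks ! k\<close> in every other variable \<open>k\<close>.  Keeping the parameters in a separate family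
  indexed by \<open>'s + nat\<close> lets a type have \<open>\<lambda>\<close> of them although each of its formulas mentions only
  finitely many.
\<close>

datatype 's cst =
    Base
  | Realizer "('s fm \<times> nat \<times> ('s + nat) list) set" "'s + nat \<Rightarrow> 's cst"

definition slot :: "('i \<Rightarrow> 'a) \<Rightarrow> nat \<Rightarrow> 'i list \<Rightarrow> 'a \<Rightarrow> nat \<Rightarrow> 'a" where
  "slot b i ks x = (\<lambda>k. b (ks ! k))(i := x)"

lemma comp_slot: "h \<circ> slot b i ks c = slot (h \<circ> b) i ks (h c)"
  unfolding slot_def by (rule ext) simp

text \<open>
  A pair \<open>(\<phi>, \<rho>)\<close> is a sentence with constants: \<open>\<rho>\<close> puts constants in the free variables of \<open>\<phi>\<close>.
  An interpretation \<open>h\<close> of the constants in \<open>M\<close> makes it true or false.  The filter is generated by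
  the sets of interpretations that satisfy a member of \<open>F\<close>; it is proper exactly if
  \<open>F\<close> is finitely satisfiable in \<open>M\<close>, and it then plays the role of an ultraproduct filter.
\<close>

definition diagram_filter ::
    "('s, 'm) L_struct \<Rightarrow> ('s fm \<times> (nat \<Rightarrow> 'c)) set \<Rightarrow> ('c \<Rightarrow> 'm) filter" where
  "diagram_filter M F =
     inf (INF \<theta>\<in>F. principal {h. sat M (h \<circ> snd \<theta>) (fst \<theta>)}) (principal {h. range h \<subseteq> univ M})"

lemma eventually_INF_principal_inf:
  "eventually Q (inf (INF \<theta>\<in>F. principal (A \<theta>)) (principal B)) \<longleftrightarrow>
    (\<exists>X\<subseteq>F. finite X \<and> (\<forall>h. (\<forall>\<theta>\<in>X. h \<in> A \<theta>) \<longrightarrow> h \<in> B \<longrightarrow> Q h))"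
proof -
  have *: "eventually R (INF \<theta>\<in>X. principal (A \<theta>)) \<longleftrightarrow> (\<forall>h. (\<forall>\<theta>\<in>X. h \<in> A \<theta>) \<longrightarrow> R h)"
    if "finite X" for X R
    unfolding INF_principal_finite[OF that] eventually_principal Ball_def INT_iff ..
  have "eventually Q (inf (INF \<theta>\<in>F. principal (A \<theta>)) (principal B)) \<longleftrightarrow>
      (\<exists>X\<subseteq>F. finite X \<and> eventually (\<lambda>h. h \<in> B \<longrightarrow> Q h) (INF \<theta>\<in>X. principal (A \<theta>)))"
    unfolding eventually_inf_principal by (rule eventually_INF)
  also have "\<dots> \<longleftrightarrow> (\<exists>X\<subseteq>F. finite X \<and> (\<forall>h. (\<forall>\<theta>\<in>X. h \<in> A \<theta>) \<longrightarrow> h \<in> B \<longrightarrow> Q h))"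
    using *[of _ "\<lambda>h. h \<in> B \<longrightarrow> Q h"] by (simp cong: conj_cong)
  finally show ?thesis .
qed

lemma eventually_diagram_filter:
  "eventually Q (diagram_filter M F) \<longleftrightarrow>
    (\<exists>X\<subseteq>F. finite X \<and> (\<forall>h. (\<forall>(\<phi>, \<rho>)\<in>X. sat M (h \<circ> \<rho>) \<phi>) \<longrightarrow> range h \<subseteq> univ M \<longrightarrow> Q h))"
  unfolding diagram_filter_def case_prod_unfold eventually_INF_principal_inf mem_Collect_eq ..

lemma eventually_diagram_filter_member:
  assumes "(\<phi>, \<rho>) \<in> F"
  shows "eventually (\<lambda>h. sat M (h \<circ> \<rho>) \<phi>) (diagram_filter M F)"
  unfolding eventually_diagram_filter using assms by (intro exI[of _ "{(\<phi>, \<rho>)}"]) auto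

lemma eventually_diagram_filter_range:
  "eventually (\<lambda>h. range h \<subseteq> univ M) (diagram_filter M F)"
  unfolding eventually_diagram_filter by (intro exI[of _ "{}"]) auto

lemma diagram_filter_antimono:
  assumes "F \<subseteq> G" shows "diagram_filter M G \<le> diagram_filter M F"
  unfolding le_filter_def eventually_diagram_filter using assms by (meson subset_trans)

text \<open>
  Consistency of a type with a diagram, in a semantic form that can only get lost when the
  diagram grows.
\<close>

definition realizable ::
    "('s, 'm) L_struct \<Rightarrow> ('s fm \<times> (nat \<Rightarrow> 'c)) set \<Rightarrow>
     ('s fm \<times> nat \<times> 'i list) set \<Rightarrow> ('i \<Rightarrow> 'c) \<Rightarrow> bool" where
  "realizable M F P b \<longleftrightarrow> (\<forall>Q\<subseteq>P. finite Q \<longrightarrow>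
     (\<exists>\<^sub>F h in diagram_filter M F. \<exists>x\<in>univ M. \<forall>(\<phi>, i, ks)\<in>Q. sat M (slot (h \<circ> b) i ks x) \<phi>))"

lemma realizable_antimono:
  assumes "F \<subseteq> G" "realizable M G P b" shows "realizable M F P b"
  using assms diagram_filter_antimono[OF assms(1), of M]
  unfolding realizable_def frequently_def by (meson filter_leD)

definition instances ::
    "'c \<Rightarrow> ('s fm \<times> nat \<times> 'i list) set \<Rightarrow> ('i \<Rightarrow> 'c) \<Rightarrow> ('s fm \<times> (nat \<Rightarrow> 'c)) set" where
  "instances c P b = (\<lambda>(\<phi>, i, ks). (\<phi>, slot b i ks c)) ` P"

text \<open>
  The tautology \<open>c = c\<close> serves as a marker, so that a diagram alone records which constants are
  already in use and inclusion of diagrams suffices for Zorn's lemma.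
\<close>

definition named :: "('s fm \<times> (nat \<Rightarrow> 'c)) set \<Rightarrow> 'c set" where
  "named F = {c. (Eq (Var 0) (Var 0), \<lambda>_. c) \<in> F}"

text \<open>
  The last condition speaks of consistency with all of \<open>F\<close>.  As consistency is inherited by
  smaller diagrams, an enlargement that names no new constant preserves the condition, and
  so do unions of chains.  A new constant is governed by it from the moment it gets named.
\<close>

definition henkin_diagram ::
    "('s, 'm) L_struct \<Rightarrow> ('s fm \<times> (nat \<Rightarrow> 's cst)) set \<Rightarrow> bool" where
  "henkin_diagram M F \<longleftrightarrow>
     \<not> eventually (\<lambda>_. False) (diagram_filter M F) \<and> Base \<in> named F \<and>
     (\<forall>\<phi> \<rho> k. (\<phi>, \<rho>) \<in> F \<longrightarrow> k \<in> fv \<phi> \<longrightarrow> \<rho> k \<in> named F) \<and>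
     (\<forall>P b k. Realizer P b \<in> named F \<longrightarrow> b k \<in> named F) \<and>
     (\<forall>P b. Realizer P b \<in> named F \<longrightarrow> realizable M F P b \<longrightarrow>
        instances (Realizer P b) P b \<subseteq> F)"

lemma henkin_diagramI:
  assumes "\<not> eventually (\<lambda>_. False) (diagram_filter M F)" "Base \<in> named F"
    and "\<And>\<phi> \<rho> k. \<lbrakk>(\<phi>, \<rho>) \<in> F; k \<in> fv \<phi>\<rbrakk> \<Longrightarrow> \<rho> k \<in> named F"
    and "\<And>P b k. Realizer P b \<in> named F \<Longrightarrow> b k \<in> named F"
    and "\<And>P b. \<lbrakk>Realizer P b \<in> named F; realizable M F P b\<rbrakk> \<Longrightarrow> instances (Realizer P b) P b \<subseteq> F"
  shows "henkin_diagram M F"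
  unfolding henkin_diagram_def using assms by blast

lemma henkin_diagramD:
  assumes "henkin_diagram M F"
  shows "\<not> eventually (\<lambda>_. False) (diagram_filter M F)" "Base \<in> named F"
    and "\<And>\<phi> \<rho> k. \<lbrakk>(\<phi>, \<rho>) \<in> F; k \<in> fv \<phi>\<rbrakk> \<Longrightarrow> \<rho> k \<in> named F"
    and "\<And>P b k. Realizer P b \<in> named F \<Longrightarrow> b k \<in> named F"
    and "\<And>P b. \<lbrakk>Realizer P b \<in> named F; realizable M F P b\<rbrakk> \<Longrightarrow> instances (Realizer P b) P b \<subseteq> F"
  using assms unfolding henkin_diagram_def by blast+

lemma named_insert:
  assumes "\<rho> ` fv \<phi> \<subseteq> named F"
  shows "named (insert (\<phi>, \<rho>) F) = named F"
proof
  show "named (insert (\<phi>, \<rho>) F) \<subseteq> named F"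
  proof
    fix c assume "c \<in> named (insert (\<phi>, \<rho>) F)"
    then consider "\<phi> = Eq (Var 0) (Var 0)" "\<rho> = (\<lambda>_. c)" | "c \<in> named F"
      unfolding named_def by auto
    then show "c \<in> named F"
      using assms by cases auto
  qed
qed (auto simp: named_def)

text \<open>
  Applied to a maximal diagram, this yields completeness: of a formula and its negation, at
  least one holds frequently.
\<close>

lemma henkin_diagram_insert:
  assumes F: "henkin_diagram M F" and \<rho>: "\<rho> ` fv \<phi> \<subseteq> named F"
    and freq: "\<exists>\<^sub>F h in diagram_filter M F. sat M (h \<circ> \<rho>) \<phi>"
  shows "henkin_diagram M (insert (\<phi>, \<rho>) F)"
proof -
  have "\<not> eventually (\<lambda>_. False) (diagram_filter M (insert (\<phi>, \<rho>) F))"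
  proof
    assume "eventually (\<lambda>_. False) (diagram_filter M (insert (\<phi>, \<rho>) F))"
    then obtain X where X: "X \<subseteq> insert (\<phi>, \<rho>) F" "finite X"
        "\<And>h. range h \<subseteq> univ M \<Longrightarrow> \<not> (\<forall>(\<phi>, \<rho>)\<in>X. sat M (h \<circ> \<rho>) \<phi>)"
      unfolding eventually_diagram_filter by blast
    have "eventually (\<lambda>h. \<not> sat M (h \<circ> \<rho>) \<phi>) (diagram_filter M F)"
      unfolding eventually_diagram_filter
      using X by (intro exI[of _ "X - {(\<phi>, \<rho>)}"]) fastforce
    with freq show False unfolding frequently_def by blast
  qed
  then show ?thesis
  proof (rule henkin_diagramI)
    show "Base \<in> named (insert (\<phi>, \<rho>) F)"
      unfolding named_insert[OF \<rho>] by (rule henkin_diagramD(2)[OF F])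
    show "\<rho>' k \<in> named (insert (\<phi>, \<rho>) F)" if "(\<phi>', \<rho>') \<in> insert (\<phi>, \<rho>) F" "k \<in> fv \<phi>'" for \<phi>' \<rho>' k
      unfolding named_insert[OF \<rho>] using that \<rho> henkin_diagramD(3)[OF F, of \<phi>' \<rho>' k] by auto
    show "b k \<in> named (insert (\<phi>, \<rho>) F)" if "Realizer P b \<in> named (insert (\<phi>, \<rho>) F)" for P b k
      using that unfolding named_insert[OF \<rho>] by (rule henkin_diagramD(4)[OF F])
    show "instances (Realizer P b) P b \<subseteq> insert (\<phi>, \<rho>) F"
      if "Realizer P b \<in> named (insert (\<phi>, \<rho>) F)" "realizable M (insert (\<phi>, \<rho>) F) P b" for P b
      using henkin_diagramD(5)[OF F] that realizable_antimono[OF subset_insertI]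
      unfolding named_insert[OF \<rho>] by (metis subset_insertI2)
  qed
qed

lemma henkin_diagram_Union:
  assumes ne: "\<C> \<noteq> {}" and chain: "subset.chain {F. henkin_diagram M F} \<C>"
  shows "henkin_diagram M (\<Union>\<C>)"
proof -
  have H: "henkin_diagram M F" if "F \<in> \<C>" for F
    using chain that unfolding subset_chain_def by blast
  have "\<not> eventually (\<lambda>_. False) (diagram_filter M (\<Union>\<C>))"
  proof
    assume "eventually (\<lambda>_. False) (diagram_filter M (\<Union>\<C>))"
    then obtain X where X: "X \<subseteq> \<Union>\<C>" "finite X"
        "\<And>h. range h \<subseteq> univ M \<Longrightarrow> \<not> (\<forall>(\<phi>, \<rho>)\<in>X. sat M (h \<circ> \<rho>) \<phi>)"
      unfolding eventually_diagram_filter by blast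
    obtain F where "F \<in> \<C>" "X \<subseteq> F"
      using finite_subset_Union_chain[OF X(2,1) ne chain] by blast
    then have "eventually (\<lambda>_. False) (diagram_filter M F)"
      unfolding eventually_diagram_filter using X by blast
    then show False
      using henkin_diagramD(1)[OF H[OF \<open>F \<in> \<C>\<close>]] by contradiction
  qed
  then show ?thesis
  proof (rule henkin_diagramI)
    have mono: "named F \<subseteq> named (\<Union>\<C>)" if "F \<in> \<C>" for F
      using that unfolding named_def by blast
    have pick: "\<exists>F\<in>\<C>. c \<in> named F" if "c \<in> named (\<Union>\<C>)" for c
      using that unfolding named_def by blast
    obtain F where "F \<in> \<C>" using ne by blast
    then show "Base \<in> named (\<Union>\<C>)"
      using mono henkin_diagramD(2)[OF H] by blast
    show "\<rho> k \<in> named (\<Union>\<C>)" if "(\<phi>, \<rho>) \<in> \<Union>\<C>" "k \<in> fv \<phi>" for \<phi> \<rho> k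
    proof -
      obtain F where F: "F \<in> \<C>" "(\<phi>, \<rho>) \<in> F"
        using \<open>(\<phi>, \<rho>) \<in> \<Union>\<C>\<close> by blast
      show ?thesis
        using mono[OF F(1)] henkin_diagramD(3)[OF H[OF F(1)] F(2) \<open>k \<in> fv \<phi>\<close>] by blast
    qed
    show "b k \<in> named (\<Union>\<C>)" if "Realizer P b \<in> named (\<Union>\<C>)" for P b k
    proof -
      obtain F where F: "F \<in> \<C>" "Realizer P b \<in> named F"
        using pick[OF \<open>Realizer P b \<in> named (\<Union>\<C>)\<close>] by blast
      show ?thesis
        using mono[OF F(1)] henkin_diagramD(4)[OF H[OF F(1)] F(2)] by blast
    qed
    show "instances (Realizer P b) P b \<subseteq> \<Union>\<C>"
      if Pb: "Realizer P b \<in> named (\<Union>\<C>)" "realizable M (\<Union>\<C>) P b" for P b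
    proof -
      obtain F where F: "F \<in> \<C>" "Realizer P b \<in> named F"
        using pick[OF Pb(1)] by blast
      then have "instances (Realizer P b) P b \<subseteq> F"
        using henkin_diagramD(5)[OF H[OF F(1)] F(2) realizable_antimono[OF Union_upper[OF F(1)] Pb(2)]]
        by blast
      then show ?thesis using F(1) by blast
    qed
  qed
qed

lemma henkin_diagram_Base:
  assumes "is_struct M"
  shows "henkin_diagram M {(Eq (Var 0) (Var 0), \<lambda>_. Base)}"
proof -
  obtain x where "x \<in> univ M"
    using assms unfolding is_struct_def by blast
  then have "\<not> eventually (\<lambda>_. False) (diagram_filter M {(Eq (Var 0) (Var 0), \<lambda>_. Base)})"
    unfolding eventually_diagram_filter by (auto intro!: exI[of _ "\<lambda>_. x"])
  then show ?thesis
    by (rule henkin_diagramI) (auto simp: named_def dest: fun_cong)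
qed

text \<open>
  The fresh constant \<open>c\<close> occurs neither in \<open>F\<close> nor among the parameters \<open>b\<close>.  So an
  interpretation of finitely many members of \<open>F\<close> for which finitely many formulas of the
  type have a common solution \<open>x\<close> may be changed at \<open>c\<close> to \<open>x\<close> without harm.
\<close>

lemma henkin_diagram_extend:
  fixes M :: "('s, 'm) L_struct"
  assumes M: "is_struct M" and F: "henkin_diagram M F"
    and b: "range b \<subseteq> named F" and fresh: "Realizer P b \<notin> named F"
  shows "\<exists>G. henkin_diagram M G \<and> F \<subseteq> G \<and> Realizer P b \<in> named G"
proof -
  define c where "c = Realizer P b"
  define E where "E = (if realizable M F P b then instances c P b else {})"
  define G where "G = insert (Eq (Var 0) (Var 0), \<lambda>_. c) (F \<union> E)"
  have bn: "b k \<in> named F" for k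
    using b by blast
  then have bc: "b k \<noteq> c" for k
    using fresh unfolding c_def by metis
  have E_vars: "\<rho> k = c \<or> \<rho> k \<in> named F" if "(\<phi>, \<rho>) \<in> E" for \<phi> \<rho> k
    using that bn unfolding E_def instances_def slot_def by (auto split: if_splits)
  have F_vars: "\<rho> ` fv \<phi> \<subseteq> named F" if "(\<phi>, \<rho>) \<in> F" for \<phi> \<rho>
    using henkin_diagramD(3)[OF F] that by blast
  have sub: "F \<subseteq> G" unfolding G_def by blast
  have named: "named G = insert c (named F)"
  proof
    show "named G \<subseteq> insert c (named F)"
    proof
      fix d assume "d \<in> named G"
      then consider "d = c" | "d \<in> named F" | "(Eq (Var 0) (Var 0), \<lambda>_. d) \<in> E"
        unfolding named_def G_def by (auto dest: fun_cong)
      then show "d \<in> insert c (named F)"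
        using E_vars by cases auto
    qed
  qed (auto simp: named_def G_def)
  have "\<not> eventually (\<lambda>_. False) (diagram_filter M G)"
  proof
    assume "eventually (\<lambda>_. False) (diagram_filter M G)"
    then obtain X where X: "X \<subseteq> G" "finite X"
        "\<And>h. range h \<subseteq> univ M \<Longrightarrow> \<not> (\<forall>(\<phi>, \<rho>)\<in>X. sat M (h \<circ> \<rho>) \<phi>)"
      unfolding eventually_diagram_filter by blast
    define inst where "inst = (\<lambda>(\<phi> :: 's fm, i, ks). (\<phi>, slot b i ks c))"
    define sats where "sats Q h \<longleftrightarrow> (\<exists>x\<in>univ M. \<forall>(\<phi>, i, ks)\<in>Q. sat M (slot (h \<circ> b) i ks x) \<phi>)" for Q h
    have "\<exists>Q\<subseteq>P. finite Q \<and> X \<inter> E = inst ` Q \<and> (\<exists>\<^sub>F h in diagram_filter M F. sats Q h)"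
    proof (cases "realizable M F P b")
      case True
      have "E = inst ` P"
        using True unfolding E_def instances_def inst_def by simp
      then have "X \<inter> E \<subseteq> inst ` P" by blast
      then obtain Q where "Q \<subseteq> P" "finite Q" "X \<inter> E = inst ` Q"
        using finite_subset_image[of "X \<inter> E" inst P] X(2) by blast
      moreover have "\<exists>\<^sub>F h in diagram_filter M F. sats Q h"
        using True[unfolded realizable_def, folded sats_def] \<open>Q \<subseteq> P\<close> \<open>finite Q\<close> by blast
      ultimately show ?thesis by blast
    next
      case False
      have "E = {}"
        using False unfolding E_def by simp
      moreover have "sats {} h" for h
        using M unfolding is_struct_def sats_def by auto
      moreover have "\<exists>\<^sub>F h in diagram_filter M F. True"
        using henkin_diagramD(1)[OF F] unfolding frequently_def by simp
      ultimately show ?thesis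
        by (intro exI[of _ "{}"]) simp
    qed
    then obtain Q where Q: "X \<inter> E = inst ` Q" and freq: "\<exists>\<^sub>F h in diagram_filter M F. sats Q h"
      by blast
    have ev: "eventually (\<lambda>h. range h \<subseteq> univ M \<and> (\<forall>(\<phi>, \<rho>)\<in>X \<inter> F. sat M (h \<circ> \<rho>) \<phi>)) (diagram_filter M F)"
      unfolding eventually_diagram_filter using X(2) by (intro exI[of _ "X \<inter> F"]) auto
    obtain h where "sats Q h" and h: "range h \<subseteq> univ M" "\<And>\<phi> \<rho>. (\<phi>, \<rho>) \<in> X \<inter> F \<Longrightarrow> sat M (h \<circ> \<rho>) \<phi>"
      using frequently_ex[OF frequently_eventually_conj[OF freq ev]] by blast
    obtain x where x: "x \<in> univ M" "\<forall>(\<phi>, i, ks)\<in>Q. sat M (slot (h \<circ> b) i ks x) \<phi>"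
      using \<open>sats Q h\<close> unfolding sats_def by (rule bexE)
    let ?h = "h(c := x)"
    have "range ?h \<subseteq> univ M" using h(1) x(1) by auto
    moreover have "sat M (?h \<circ> \<rho>) \<phi>" if \<theta>: "(\<phi>, \<rho>) \<in> X" for \<phi> \<rho>
    proof -
      consider "(\<phi>, \<rho>) = (Eq (Var 0) (Var 0), \<lambda>_. c)" | "(\<phi>, \<rho>) \<in> X \<inter> F" | "(\<phi>, \<rho>) \<in> X \<inter> E"
        using \<theta> X(1) unfolding G_def by blast
      then show ?thesis
      proof cases
        case 1
        then show ?thesis by simp
      next
        case 2
        have "(?h \<circ> \<rho>) k = (h \<circ> \<rho>) k" if "k \<in> fv \<phi>" for k
          using F_vars[of \<phi> \<rho>] 2 that fresh unfolding c_def by auto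
        then have "sat M (?h \<circ> \<rho>) \<phi> = sat M (h \<circ> \<rho>) \<phi>"
          by (rule sat_cong)
        then show ?thesis using h(2)[OF 2] by simp
      next
        case 3
        then obtain i ks where Qi: "(\<phi>, i, ks) \<in> Q" "\<rho> = slot b i ks c"
          unfolding Q inst_def by auto
        have "?h \<circ> b = h \<circ> b"
          by (rule ext) (simp add: bc)
        moreover have "sat M (slot (h \<circ> b) i ks x) \<phi>"
          using bspec[OF x(2) Qi(1)] by simp
        ultimately show ?thesis
          unfolding Qi(2) comp_slot by (simp only: fun_upd_same)
      qed
    qed
    ultimately show False
      using X(3)[of ?h] by blast
  qed
  then have "henkin_diagram M G"
  proof (rule henkin_diagramI)
    show "Base \<in> named G"
      using henkin_diagramD(2)[OF F] named by blast
    show "\<rho> k \<in> named G" if "(\<phi>, \<rho>) \<in> G" "k \<in> fv \<phi>" for \<phi> \<rho> k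
      using that F_vars[of \<phi> \<rho>] E_vars[of \<phi> \<rho>] unfolding named by (auto simp: G_def)
    show "b' k \<in> named G" if "Realizer P' b' \<in> named G" for P' b' k
      using that b henkin_diagramD(4)[OF F, of P' b' k] unfolding named c_def by auto
    show "instances (Realizer P' b') P' b' \<subseteq> G"
      if "Realizer P' b' \<in> named G" "realizable M G P' b'" for P' b'
    proof -
      have r: "realizable M F P' b'"
        using realizable_antimono[OF sub that(2)] .
      from that(1) named consider "Realizer P' b' = c" | "Realizer P' b' \<in> named F" by blast
      then show ?thesis
      proof cases
        case 1
        then show ?thesis
          using r unfolding c_def G_def E_def by auto
      next
        case 2
        then show ?thesis
          using henkin_diagramD(5)[OF F _ r] sub by blast
      qed
    qed
  qed
  then show ?thesis
    using sub named unfolding c_def by blast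
qed

text \<open>
  A maximal diagram names all constants, by induction on their tree structure, and
  hence decides all formulas.  Every finitely realizable type over constants is then realized by the
  constant reserved for it.  The filter decides the sets of interpretations that formulas define, which is all
  that the quotient construction below asks of an ultrafilter.
\<close>

lemma realizing_ultrafilter:
  fixes M :: "('s, 'm) L_struct"
  assumes M: "is_struct M"
  obtains U :: "('s cst \<Rightarrow> 'm) filter"
  where "U \<noteq> bot" "eventually (\<lambda>h. range h \<subseteq> univ M) U"
    "\<forall>\<phi> \<rho>. eventually (\<lambda>h. sat M (h \<circ> \<rho>) \<phi>) U \<or> eventually (\<lambda>h. \<not> sat M (h \<circ> \<rho>) \<phi>) U"
    "\<forall>(P :: ('s fm \<times> nat \<times> ('s + nat) list) set) b.
      (\<forall>Q\<subseteq>P. finite Q \<longrightarrow>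
        (\<exists>\<^sub>F h in U. \<exists>x\<in>univ M. \<forall>(\<phi>, i, ks)\<in>Q. sat M (slot (h \<circ> b) i ks x) \<phi>)) \<longrightarrow>
      (\<exists>c. \<forall>(\<phi>, i, ks)\<in>P. eventually (\<lambda>h. sat M (slot (h \<circ> b) i ks (h c)) \<phi>) U)"
proof -
  have "\<exists>F\<in>{F. henkin_diagram M F}. \<forall>G\<in>{F. henkin_diagram M F}. F \<subseteq> G \<longrightarrow> G = F"
    by (rule subset_Zorn_nonempty) (use henkin_diagram_Base[OF M] henkin_diagram_Union in auto)
  then obtain F where F: "henkin_diagram M F"
      and max: "\<And>G. henkin_diagram M G \<Longrightarrow> F \<subseteq> G \<Longrightarrow> G = F"
    by blast
  let ?U = "diagram_filter M F"
  have all: "c \<in> named F" for c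
  proof (induction c)
    case Base
    show ?case by (rule henkin_diagramD(2)[OF F])
  next
    case (Realizer P b)
    then have "range b \<subseteq> named F" by auto
    then show ?case
      using henkin_diagram_extend[OF M F, of b P] max by metis
  qed
  show thesis
  proof
    show "?U \<noteq> bot" using henkin_diagramD(1)[OF F] unfolding trivial_limit_def .
    show "eventually (\<lambda>h. range h \<subseteq> univ M) ?U" by (rule eventually_diagram_filter_range)
    show "\<forall>\<phi> \<rho>. eventually (\<lambda>h. sat M (h \<circ> \<rho>) \<phi>) ?U \<or> eventually (\<lambda>h. \<not> sat M (h \<circ> \<rho>) \<phi>) ?U"
    proof (intro allI)
      fix \<phi> \<rho>
      show "eventually (\<lambda>h. sat M (h \<circ> \<rho>) \<phi>) ?U \<or> eventually (\<lambda>h. \<not> sat M (h \<circ> \<rho>) \<phi>) ?U"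
      proof (cases "\<exists>\<^sub>F h in ?U. sat M (h \<circ> \<rho>) \<phi>")
        case True
        then have "henkin_diagram M (insert (\<phi>, \<rho>) F)"
          using all by (intro henkin_diagram_insert[OF F]) auto
        then have "(\<phi>, \<rho>) \<in> F" using max by blast
        then show ?thesis by (simp add: eventually_diagram_filter_member)
      qed (simp add: frequently_def)
    qed
    show "\<forall>(P :: ('s fm \<times> nat \<times> ('s + nat) list) set) b.
      (\<forall>Q\<subseteq>P. finite Q \<longrightarrow>
        (\<exists>\<^sub>F h in ?U. \<exists>x\<in>univ M. \<forall>(\<phi>, i, ks)\<in>Q. sat M (slot (h \<circ> b) i ks x) \<phi>)) \<longrightarrow>
      (\<exists>c. \<forall>(\<phi>, i, ks)\<in>P. eventually (\<lambda>h. sat M (slot (h \<circ> b) i ks (h c)) \<phi>) ?U)"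
      unfolding realizable_def[symmetric]
    proof (intro allI impI)
      fix P :: "('s fm \<times> nat \<times> ('s + nat) list) set" and b
      assume "realizable M F P b"
      then have inst: "instances (Realizer P b) P b \<subseteq> F"
        by (rule henkin_diagramD(5)[OF F all])
      have "eventually (\<lambda>h. sat M (slot (h \<circ> b) i ks (h (Realizer P b))) \<phi>) ?U"
        if "(\<phi>, i, ks) \<in> P" for \<phi> i ks
      proof -
        have "(\<phi>, slot b i ks (Realizer P b)) \<in> F"
          using inst that unfolding instances_def by force
        then show ?thesis
          by (rule eventually_diagram_filter_member[where M = M and \<rho> = "slot b i ks (Realizer P b)", unfolded comp_slot])
      qed
      then show "\<exists>c. \<forall>(\<phi>, i, ks)\<in>P. eventually (\<lambda>h. sat M (slot (h \<circ> b) i ks (h c)) \<phi>) ?U"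
        by blast
    qed
  qed
qed

section \<open>Counting the constants\<close>

text \<open>
  Prefix codes in the alphabet \<open>'s + nat\<close>: concatenations can be decoded.
\<close>

fun trm_code :: "'s trm \<Rightarrow> ('s + nat) list" where
  "trm_code (Var i) = [Inr 0, Inr i]"
| "trm_code (App s t) = Inr 1 # Inl s # trm_code t"

fun fm_code :: "'s fm \<Rightarrow> ('s + nat) list" where
  "fm_code (Eq t u) = Inr 0 # trm_code t @ trm_code u"
| "fm_code (Neg \<phi>) = Inr 1 # fm_code \<phi>"
| "fm_code (Conj \<phi> \<psi>) = Inr 2 # fm_code \<phi> @ fm_code \<psi>"
| "fm_code (Ex i \<phi>) = Inr 3 # Inr i # fm_code \<phi>"

lemma trm_code_prefix_free: "trm_code t @ xs = trm_code u @ ys \<Longrightarrow> t = u \<and> xs = ys"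
proof (induction t arbitrary: u)
  case (Var i)
  then show ?case by (cases u) auto
next
  case (App s t)
  then show ?case by (cases u) auto
qed

lemma fm_code_prefix_free: "fm_code \<phi> @ xs = fm_code \<psi> @ ys \<Longrightarrow> \<phi> = \<psi> \<and> xs = ys"
proof (induction \<phi> arbitrary: \<psi> xs ys)
  case (Eq t u)
  then show ?case by (cases \<psi>) (auto dest!: trm_code_prefix_free)
next
  case (Neg \<phi>)
  then show ?case by (cases \<psi>) auto
next
  case (Conj \<phi> \<chi>)
  show ?case
  proof (cases \<psi>)
    case \<psi>: (Conj \<phi>' \<chi>')
    have "fm_code \<phi> @ (fm_code \<chi> @ xs) = fm_code \<phi>' @ (fm_code \<chi>' @ ys)"
      using Conj.prems unfolding \<psi> by simp
    from Conj.IH(1)[OF this] Conj.IH(2)[of xs \<chi>' ys] show ?thesis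
      unfolding \<psi> by simp
  qed (use Conj.prems in simp_all)
next
  case (Ex i \<phi>)
  then show ?case by (cases \<psi>) auto
qed

text \<open>
  A well-founded tree is determined by its labelled paths from the root.  The label \<open>None\<close>
  marks the presence of a node, which distinguishes a node with empty \<open>P\<close> from \<open>Base\<close>.
\<close>

primrec cst_code :: "'s cst \<Rightarrow> (('s + nat) list \<times> ('s + nat) list option) set" where
  "cst_code Base = {}"
| "cst_code (Realizer P b) = insert ([], None)
     ((\<lambda>(\<phi>, i, ks). ([], Some (fm_code \<phi> @ Inr i # ks))) ` P \<union>
      (\<Union>k. (\<lambda>(p, l). (k # p, l)) ` cst_code (b k)))"

lemma cst_code_inject: "cst_code c = cst_code d \<Longrightarrow> c = d"
proof (induction c arbitrary: d)
  case Base
  then show ?case by (cases d) auto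
next
  case (Realizer P b)
  show ?case
  proof (cases d)
    case Base
    then show ?thesis using Realizer.prems by auto
  next
    case d: (Realizer P' b')
    have root: "(\<phi>, i, ks) \<in> P \<longleftrightarrow> ([], Some (fm_code \<phi> @ Inr i # ks)) \<in> cst_code (Realizer P b)"
      for P b \<phi> i ks
      by (force dest: fm_code_prefix_free)
    have child: "(p, l) \<in> cst_code (b k) \<longleftrightarrow> (k # p, l) \<in> cst_code (Realizer P b)" for P b k p l
      by force
    have eq: "cst_code (Realizer P b) = cst_code (Realizer P' b')"
      using Realizer.prems unfolding d .
    have "(\<phi>, i, ks) \<in> P \<longleftrightarrow> (\<phi>, i, ks) \<in> P'" for \<phi> i ks
      using root[of \<phi> i ks P b] root[of \<phi> i ks P' b'] unfolding eq by (rule HOL.trans[OF _ sym])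
    then have "P = P'"
      by auto
    moreover have "b k = b' k" for k
    proof (rule Realizer.IH)
      have "(p, l) \<in> cst_code (b k) \<longleftrightarrow> (p, l) \<in> cst_code (b' k)" for p l
        using child[of p l b k P] child[of p l b' k P'] unfolding eq by (rule HOL.trans[OF _ sym])
      then show "cst_code (b k) = cst_code (b' k)"
        by auto
    qed simp
    ultimately show ?thesis unfolding d by auto
  qed
qed

text \<open>
  There are \<open>\<lambda>\<close> many labelled paths, because an infinite alphabet is equipotent to the set of its
  words.  Hence there are at most \<open>2\<^sup>\<lambda>\<close> trees, although each of them branches \<open>\<lambda>\<close> times at every node.
\<close>

lemma cst_lepoll: "(UNIV :: 's cst set) \<lesssim> (UNIV :: ('s + nat) set set)"
proof -
  have "infinite (UNIV :: ('s + nat) set)"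
    by (metis finite_Plus_UNIV_iff infinite_UNIV_nat)
  then obtain f :: "('s + nat) list \<Rightarrow> 's + nat" where f: "bij f"
    using lists_infinite_bij_betw_types by blast
  have inj_f: "f x = f y \<longleftrightarrow> x = y" for x y
    using f by (simp add: bij_is_inj inj_eq)
  define e where "e pl = f (f (fst pl) # (case snd pl of None \<Rightarrow> [] | Some l \<Rightarrow> [f l]))"
    for pl :: "('s + nat) list \<times> ('s + nat) list option"
  have "inj e"
    unfolding inj_def e_def inj_f by (auto simp: inj_f split: option.splits)
  then have "inj (\<lambda>c :: 's cst. e ` cst_code c)"
    unfolding inj_def by (simp add: inj_image_eq_iff cst_code_inject inj_def)
  then show ?thesis
    unfolding lepoll_def by blast
qed

section \<open>Saturated elementarily equivalent structures\<close>

text \<open>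
  The model consists of the constants, two of which are identified when almost all
  interpretations agree on them; its elements are named in \<open>'u\<close> by a choice of representatives.
  Truth in it is truth almost everywhere, as in the theorem of Los on ultraproducts.  The constants
  reserved for one-formula types provide the witnesses that the quantifier step needs, and those
  reserved for types with \<open>\<lambda>\<close> parameters give saturation.
\<close>

theorem saturated_elementarily_equivalent:
  fixes M :: "('s, 'm) L_struct"
  assumes large: "large_universe TYPE('s) TYPE('u)" and M: "is_struct M"
  obtains N :: "('s, 'u) L_struct"
  where "is_struct N" "saturated N" "\<And>\<phi>. sentence \<phi> \<Longrightarrow> holds N \<phi> [] = holds M \<phi> []"
proof -
  obtain U :: "('s cst \<Rightarrow> 'm) filter" where nontrivial: "U \<noteq> bot"
    and range: "eventually (\<lambda>h. range h \<subseteq> univ M) U"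
    and "\<forall>\<phi> \<rho>. eventually (\<lambda>h. sat M (h \<circ> \<rho>) \<phi>) U \<or> eventually (\<lambda>h. \<not> sat M (h \<circ> \<rho>) \<phi>) U"
    and "\<forall>(P :: ('s fm \<times> nat \<times> ('s + nat) list) set) b.
      (\<forall>Q\<subseteq>P. finite Q \<longrightarrow>
        (\<exists>\<^sub>F h in U. \<exists>x\<in>univ M. \<forall>(\<phi>, i, ks)\<in>Q. sat M (slot (h \<circ> b) i ks x) \<phi>)) \<longrightarrow>
      (\<exists>c. \<forall>(\<phi>, i, ks)\<in>P. eventually (\<lambda>h. sat M (slot (h \<circ> b) i ks (h c)) \<phi>) U)"
    by (rule realizing_ultrafilter[OF M]) (rule that)
  note ultra = this(3)[rule_format] and realizer = this(4)[THEN spec, THEN spec, THEN mp]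
  have witness: "\<exists>c. eventually (\<lambda>h. sat M (h \<circ> \<rho>(i := c)) \<phi>) U"
    if ex: "\<exists>\<^sub>F h in U. \<exists>x\<in>univ M. sat M ((h \<circ> \<rho>)(i := x)) \<phi>" for \<phi> \<rho> i
  proof -
    obtain n where n: "fv \<phi> \<subseteq> {..<n}"
      using finite_nat_bounded[OF finite_fv] by blast
    define b where "b = case_sum (\<lambda>_ :: 's. Base) \<rho>"
    define ks :: "('s + nat) list" where "ks = map Inr [0..<n]"
    have eq: "sat M (slot (h \<circ> b) i ks x) \<phi> = sat M ((h \<circ> \<rho>)(i := x)) \<phi>" for h x
    proof (rule sat_cong)
      fix k assume "k \<in> fv \<phi>"
      then have "k < n" using n by blast
      then show "slot (h \<circ> b) i ks x k = ((h \<circ> \<rho>)(i := x)) k"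
        unfolding slot_def b_def ks_def by simp
    qed
    have "\<exists>c. \<forall>(\<phi>, i, ks)\<in>{(\<phi>, i, ks)}. eventually (\<lambda>h. sat M (slot (h \<circ> b) i ks (h c)) \<phi>) U"
    proof (rule realizer, intro allI impI)
      fix Q assume Q: "Q \<subseteq> {(\<phi>, i, ks)}"
      show "\<exists>\<^sub>F h in U. \<exists>x\<in>univ M. \<forall>(\<phi>, i, ks)\<in>Q. sat M (slot (h \<circ> b) i ks x) \<phi>"
        using ex
      proof (rule frequently_elim1)
        fix h assume "\<exists>x\<in>univ M. sat M ((h \<circ> \<rho>)(i := x)) \<phi>"
        then show "\<exists>x\<in>univ M. \<forall>(\<phi>, i, ks)\<in>Q. sat M (slot (h \<circ> b) i ks x) \<phi>"
          unfolding eq[symmetric] using Q by fastforce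
      qed
    qed
    then show ?thesis by (simp add: eq fun_upd_comp)
  qed
  obtain g :: "'s cst \<Rightarrow> 'u" where g: "inj g"
    using lepoll_trans[OF cst_lepoll large[unfolded large_universe_def]] unfolding lepoll_def by blast
  define weq where "weq c d \<longleftrightarrow> eventually (\<lambda>h. h c = h d) U" for c d
  have weq_refl: "weq c c" for c
    unfolding weq_def by simp
  have weq_sym: "weq d c" if "weq c d" for c d
    using that unfolding weq_def by (rule eventually_mono) simp
  have weq_trans: "weq c e" if "weq c d" "weq d e" for c d e
    using that unfolding weq_def by eventually_elim simp
  define j where "j c = g (SOME d. weq c d)" for c
  have j_eq: "j c = j d \<longleftrightarrow> weq c d" for c d
  proof
    assume "j c = j d"
    then have "(SOME e. weq c e) = (SOME e. weq d e)"
      using g unfolding j_def by (simp add: inj_eq)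
    then show "weq c d"
      using someI[of "weq c", OF weq_refl] someI[of "weq d", OF weq_refl] weq_sym weq_trans by metis
  next
    assume "weq c d"
    then have "weq c = weq d"
      using weq_sym weq_trans by blast
    then show "j c = j d" unfolding j_def by simp
  qed
  \<comment> \<open>The function symbols act on constants through witnesses for the existence of values.\<close>
  define app where "app s c = (SOME d. eventually (\<lambda>h. act M s (h c) = h d) U)" for s c
  have app: "eventually (\<lambda>h. act M s (h c) = h (app s c)) U" for s c
  proof -
    have "eventually (\<lambda>h. \<exists>x\<in>univ M. sat M ((h \<circ> (\<lambda>_. c))(1 := x)) (Eq (App s (Var 0)) (Var 1))) U"
      using range by (rule eventually_mono) (use M in \<open>auto simp: is_struct_def\<close>)
    then obtain d where "eventually (\<lambda>h. sat M (h \<circ> (\<lambda>_. c)(1 := d)) (Eq (App s (Var 0)) (Var 1))) U"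
      using witness eventually_frequently[OF nontrivial] by blast
    then have "eventually (\<lambda>h. act M s (h c) = h d) U"
      by simp
    then show ?thesis
      unfolding app_def by (rule someI)
  qed
  define N where "N = \<lparr>univ = range j, act = (\<lambda>s x. j (app s (SOME c. j c = x)))\<rparr>"
  have univ_N: "univ N = range j" unfolding N_def by simp
  have act_N: "act N s (j c) = j (app s c)" for s c
  proof -
    have "j (SOME d. j d = j c) = j c"
      by (rule someI) (rule refl)
    then have "weq (SOME d. j d = j c) c"
      unfolding j_eq .
    then have "eventually (\<lambda>h. h (app s (SOME d. j d = j c)) = h (app s c)) U"
      using app[of s "SOME d. j d = j c"] app[of s c] unfolding weq_def
      by eventually_elim simp
    then show ?thesis
      unfolding N_def using j_eq[unfolded weq_def] by simp
  qed
  have struct: "is_struct N"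
    unfolding is_struct_def univ_N by (auto simp: act_N)
  have term_value: "\<exists>c. tval N (j \<circ> \<rho>) t = j c \<and> eventually (\<lambda>h. tval M (h \<circ> \<rho>) t = h c) U" for \<rho> t
  proof (induction t)
    case (Var i)
    show ?case by (intro exI[of _ "\<rho> i"]) simp
  next
    case (App s t)
    then obtain c where c: "tval N (j \<circ> \<rho>) t = j c" "eventually (\<lambda>h. tval M (h \<circ> \<rho>) t = h c) U"
      by blast
    have "eventually (\<lambda>h. tval M (h \<circ> \<rho>) (App s t) = h (app s c)) U"
      using c(2) app[of s c] by eventually_elim simp
    moreover have "tval N (j \<circ> \<rho>) (App s t) = j (app s c)"
      using c(1) act_N by simp
    ultimately show ?case by blast
  qed
  have truth: "sat N (j \<circ> \<rho>) \<phi> \<longleftrightarrow> eventually (\<lambda>h. sat M (h \<circ> \<rho>) \<phi>) U" for \<rho> \<phi>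
  proof (induction \<phi> arbitrary: \<rho>)
    case (Eq t u)
    obtain c where c: "tval N (j \<circ> \<rho>) t = j c" "eventually (\<lambda>h. tval M (h \<circ> \<rho>) t = h c) U"
      using term_value[of \<rho> t] by blast
    obtain d where d: "tval N (j \<circ> \<rho>) u = j d" "eventually (\<lambda>h. tval M (h \<circ> \<rho>) u = h d) U"
      using term_value[of \<rho> u] by blast
    have "eventually (\<lambda>h. (tval M (h \<circ> \<rho>) t = tval M (h \<circ> \<rho>) u) = (h c = h d)) U"
      using c(2) d(2) by eventually_elim simp
    then show ?case
      unfolding sat.simps c(1) d(1) j_eq weq_def by (rule eventually_subst[symmetric])
  next
    case (Neg \<phi>)
    have "\<not> (eventually (\<lambda>h. sat M (h \<circ> \<rho>) \<phi>) U \<and> eventually (\<lambda>h. \<not> sat M (h \<circ> \<rho>) \<phi>) U)"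
      using nontrivial eventually_conj[of "\<lambda>h. sat M (h \<circ> \<rho>) \<phi>" U "\<lambda>h. \<not> sat M (h \<circ> \<rho>) \<phi>"]
      by (auto simp: trivial_limit_def)
    then show ?case
      unfolding sat.simps Neg.IH using ultra[of \<rho> \<phi>] by blast
  next
    case (Conj \<phi> \<psi>)
    then show ?case by (simp only: sat.simps eventually_conj_iff)
  next
    case (Ex i \<phi>)
    have "sat N (j \<circ> \<rho>) (Ex i \<phi>) \<longleftrightarrow> (\<exists>c. sat N (j \<circ> \<rho>(i := c)) \<phi>)"
      unfolding sat.simps univ_N by (simp only: bex_simps fun_upd_comp)
    also have "\<dots> \<longleftrightarrow> (\<exists>c. eventually (\<lambda>h. sat M (h \<circ> \<rho>(i := c)) \<phi>) U)"
      unfolding Ex.IH ..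
    also have "\<dots> \<longleftrightarrow> eventually (\<lambda>h. sat M (h \<circ> \<rho>) (Ex i \<phi>)) U"
    proof
      assume "\<exists>c. eventually (\<lambda>h. sat M (h \<circ> \<rho>(i := c)) \<phi>) U"
      then obtain c where "eventually (\<lambda>h. sat M (h \<circ> \<rho>(i := c)) \<phi>) U" by blast
      with range show "eventually (\<lambda>h. sat M (h \<circ> \<rho>) (Ex i \<phi>)) U"
        by eventually_elim (auto simp only: sat.simps fun_upd_comp)
    next
      assume "eventually (\<lambda>h. sat M (h \<circ> \<rho>) (Ex i \<phi>)) U"
      then show "\<exists>c. eventually (\<lambda>h. sat M (h \<circ> \<rho>(i := c)) \<phi>) U"
        using witness eventually_frequently[OF nontrivial] unfolding sat.simps by blast
    qed
    finally show ?case .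
  qed
  have "holds N \<phi> [] = holds M \<phi> []" if "sentence \<phi>" for \<phi>
  proof -
    have "sat M (h \<circ> (\<lambda>_. Base)) \<phi> = holds M \<phi> []" for h :: "'s cst \<Rightarrow> 'm"
      using holds_sentence[OF that] by blast
    moreover have "holds N \<phi> [] = sat N (j \<circ> (\<lambda>_. Base)) \<phi>"
      using holds_sentence[OF that] by blast
    ultimately show ?thesis
      unfolding truth using nontrivial by (simp add: eventually_const_iff)
  qed
  moreover have "saturated N"
    unfolding saturated_def
  proof (intro allI impI, elim conjE)
    fix B p
    assume B: "B \<subseteq> univ N" "B \<lesssim> (UNIV :: ('s + nat) set)"
      and p: "\<forall>(\<phi>, bs)\<in>p. set bs \<subseteq> B \<and> fv \<phi> \<subseteq> {..<Suc (length bs)}"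
      and fin: "\<forall>q. finite q \<and> q \<subseteq> p \<longrightarrow> (\<exists>c\<in>univ N. \<forall>(\<phi>, bs)\<in>q. holds N \<phi> (c # bs))"
    have "\<exists>b :: 's + nat \<Rightarrow> 's cst. B \<subseteq> range (j \<circ> b)"
    proof -
      obtain f :: "'s + nat \<Rightarrow> 'u" where f: "B \<subseteq> range f"
        using B(2) unfolding lepoll_iff by blast
      define b where "b k = (SOME c. f k \<in> B \<longrightarrow> j c = f k)" for k
      have "f k \<in> B \<longrightarrow> j (b k) = f k" for k
        unfolding b_def
      proof (rule someI_ex)
        have "B \<subseteq> range j"
          using B(1) unfolding univ_N .
        then show "\<exists>c. f k \<in> B \<longrightarrow> j c = f k"
          by (metis imageE subsetD)
      qed
      then have "B \<subseteq> range (j \<circ> b)"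
        using f by force
      then show ?thesis by blast
    qed
    then obtain b :: "'s + nat \<Rightarrow> 's cst" where b: "B \<subseteq> range (j \<circ> b)" by blast
    \<comment> \<open>Variable 0 is the realized element, so the head of each index list is an arbitrary filler.\<close>
    define P where "P = {(\<phi>, i :: nat, ks). i = 0 \<and> (\<exists>k ks'. ks = k # ks' \<and> (\<phi>, map (j \<circ> b) ks') \<in> p)}"
    have holds_slot: "holds N \<phi> (j c # map (j \<circ> b) ks) \<longleftrightarrow>
        eventually (\<lambda>h. sat M (slot (h \<circ> b) 0 (k # ks) (h c)) \<phi>) U"
      if "(\<phi>, map (j \<circ> b) ks) \<in> p" for \<phi> k ks c
    proof -
      have "fv \<phi> \<subseteq> {..<Suc (length ks)}"
        using bspec[OF p that] by simp
      then have "holds N \<phi> (j c # map (j \<circ> b) ks) = sat N (j \<circ> slot b 0 (k # ks) c) \<phi>"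
        unfolding holds_def slot_def
        by (intro sat_cong) (auto simp: nth_Cons' dest!: subsetD)
      then show ?thesis
        unfolding truth unfolding comp_slot .
    qed
    have "\<exists>c. \<forall>(\<phi>, i, ks)\<in>P. eventually (\<lambda>h. sat M (slot (h \<circ> b) i ks (h c)) \<phi>) U"
    proof (rule realizer, intro allI impI)
      fix Q assume Q: "Q \<subseteq> P" "finite Q"
      define q where "q = (\<lambda>(\<phi>, i, ks). (\<phi>, map (j \<circ> b) (tl ks))) ` Q"
      have "finite q" "q \<subseteq> p"
        using Q unfolding q_def P_def by auto
      then have "\<exists>x\<in>univ N. \<forall>(\<phi>, bs)\<in>q. holds N \<phi> (x # bs)"
        by (intro fin[THEN spec, THEN mp] conjI)
      then obtain x where x: "x \<in> univ N" "\<forall>(\<phi>, bs)\<in>q. holds N \<phi> (x # bs)"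
        by (rule bexE)
      obtain c where c: "x = j c"
        using x(1) unfolding univ_N by (rule imageE)
      have "eventually (\<lambda>h. case \<theta> of (\<phi>, i, ks) \<Rightarrow> sat M (slot (h \<circ> b) i ks (h c)) \<phi>) U"
        if \<theta>: "\<theta> \<in> Q" for \<theta>
      proof -
        obtain \<phi> k ks where \<theta>_eq: "\<theta> = (\<phi>, 0, k # ks)" and mem: "(\<phi>, map (j \<circ> b) ks) \<in> p"
          using \<theta> Q(1) unfolding P_def by auto
        have "(\<phi>, map (j \<circ> b) ks) \<in> q"
          using \<theta> unfolding q_def \<theta>_eq by force
        then show ?thesis
          using bspec[OF x(2)] holds_slot[OF mem] unfolding \<theta>_eq c by fastforce
      qed
      then have "eventually (\<lambda>h. \<forall>\<theta>\<in>Q. case \<theta> of (\<phi>, i, ks) \<Rightarrow> sat M (slot (h \<circ> b) i ks (h c)) \<phi>) U"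
        using Q(2) by (simp add: eventually_ball_finite_distrib)
      with range have "eventually (\<lambda>h. \<exists>x\<in>univ M. \<forall>(\<phi>, i, ks)\<in>Q. sat M (slot (h \<circ> b) i ks x) \<phi>) U"
        by eventually_elim auto
      then show "\<exists>\<^sub>F h in U. \<exists>x\<in>univ M. \<forall>(\<phi>, i, ks)\<in>Q. sat M (slot (h \<circ> b) i ks x) \<phi>"
        by (rule eventually_frequently[OF nontrivial])
    qed
    then obtain c where c: "\<forall>(\<phi>, i, ks)\<in>P. eventually (\<lambda>h. sat M (slot (h \<circ> b) i ks (h c)) \<phi>) U" ..
    have "holds N \<phi> (j c # bs)" if mem: "(\<phi>, bs) \<in> p" for \<phi> bs
    proof -
      have "set bs \<subseteq> range (j \<circ> b)"
        using bspec[OF p mem] b by auto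
      then obtain ks where ks: "bs = map (j \<circ> b) ks"
        by (metis ex_map_conv image_iff subsetD)
      have "(\<phi>, 0, Inr 0 # ks) \<in> P"
        using mem unfolding P_def ks by blast
      then show ?thesis
        using bspec[OF c] holds_slot[of \<phi> ks c "Inr 0"] mem unfolding ks by blast
    qed
    then show "\<exists>c\<in>univ N. \<forall>(\<phi>, bs)\<in>p. holds N \<phi> (c # bs)"
      unfolding univ_N by blast
  qed
  ultimately show thesis
    using that struct by blast
qed

section \<open>A sentence that violates primitive normality\<close>

definition linked_fm :: "'s \<Rightarrow> 's \<Rightarrow> nat \<Rightarrow> nat \<Rightarrow> nat \<Rightarrow> 's fm" where
  "linked_fm a b w i k = Ex w (Conj (Eq (App a (Var w)) (Var i)) (Eq (App b (Var w)) (Var k)))"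

definition linked :: "('s, 'a) L_struct \<Rightarrow> 's \<Rightarrow> 's \<Rightarrow> 'a \<Rightarrow> 'a \<Rightarrow> bool" where
  "linked M a b x y \<longleftrightarrow> (\<exists>z\<in>univ M. act M a z = x \<and> act M b z = y)"

lemma sat_linked_fm:
  "w \<noteq> i \<Longrightarrow> w \<noteq> k \<Longrightarrow> sat M e (linked_fm a b w i k) \<longleftrightarrow> linked M a b (e i) (e k)"
  unfolding linked_fm_def linked_def by simp

text \<open>
  The variables 0 and 1 are the left arguments and 2 and 3 the right ones: three corners of the
  rectangle belong to the relation \<open>linked\<close> and the fourth does not.
\<close>

definition defect_fm :: "'s \<Rightarrow> 's \<Rightarrow> 's fm" where
  "defect_fm a b = Ex 0 (Ex 1 (Ex 2 (Ex 3
     (Conj (Conj (linked_fm a b 4 0 2) (linked_fm a b 4 0 3))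
       (Conj (linked_fm a b 4 1 2) (Neg (linked_fm a b 4 1 3)))))))"

lemma sentence_defect_fm: "sentence (defect_fm a b)"
  unfolding sentence_def defect_fm_def linked_fm_def by auto

lemma holds_defect_fm:
  "holds M (defect_fm a b) [] \<longleftrightarrow>
    (\<exists>x\<in>univ M. \<exists>x'\<in>univ M. \<exists>y\<in>univ M. \<exists>y'\<in>univ M.
      linked M a b x y \<and> linked M a b x y' \<and> linked M a b x' y \<and> \<not> linked M a b x' y')"
  unfolding holds_def defect_fm_def by (simp add: sat_linked_fm)

lemma defect_not_primitive_normal:
  assumes "holds M (defect_fm a b) []"
  obtains \<phi> c d where "primitive \<phi>" "fv \<phi> \<subseteq> {..<1 + 1}" "c \<in> tuples M 1" "d \<in> tuples M 1"
    "def_set M 1 \<phi> c \<noteq> def_set M 1 \<phi> d" "def_set M 1 \<phi> c \<inter> def_set M 1 \<phi> d \<noteq> {}"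
proof -
  obtain x x' y y' where univ: "x \<in> univ M" "x' \<in> univ M" "y \<in> univ M" "y' \<in> univ M"
    and "linked M a b x y" "linked M a b x y'" "linked M a b x' y" "\<not> linked M a b x' y'"
    using assms unfolding holds_defect_fm by blast
  moreover have "[u] \<in> def_set M 1 (linked_fm a b 2 0 1) [v] \<longleftrightarrow> linked M a b u v"
    if "u \<in> univ M" for u v
    using that unfolding def_set_def tuples_def holds_def by (simp add: sat_linked_fm)
  ultimately have "[x] \<in> def_set M 1 (linked_fm a b 2 0 1) [y]"
      "[x] \<in> def_set M 1 (linked_fm a b 2 0 1) [y']"
      "[x'] \<in> def_set M 1 (linked_fm a b 2 0 1) [y]"
      "[x'] \<notin> def_set M 1 (linked_fm a b 2 0 1) [y']"
    by simp_all
  moreover have "primitive (linked_fm a b 2 0 1)" "fv (linked_fm a b 2 0 1) \<subseteq> {..<1 + 1}"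
    unfolding linked_fm_def by auto
  moreover have "[y] \<in> tuples M 1" "[y'] \<in> tuples M 1"
    using univ unfolding tuples_def by simp_all
  ultimately show thesis
    using that[of "linked_fm a b 2 0 1" "[y]" "[y']"] by blast
qed

lemma regular_act_isomorphic:
  fixes M :: "('s::monoid_mult, 'm) L_struct" and N :: "('s, 'u) L_struct"
  assumes M: "regular_act M" and inj: "inj_on f (univ M)" and univ: "univ N = f ` univ M"
    and act: "\<And>s x. x \<in> univ M \<Longrightarrow> act N s (f x) = f (act M s x)"
  shows "regular_act N"
proof -
  have M_act: "is_act M" and reg: "\<And>x. x \<in> univ M \<Longrightarrow> act_regular M x"
    using M unfolding regular_act_def by auto
  then have closed: "act M s x \<in> univ M" if "x \<in> univ M" for s x
    using that unfolding is_act_def is_struct_def by blast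
  have N_act: "is_act N"
    using M_act unfolding is_act_def is_struct_def univ by (auto simp: act closed)
  have "act_regular N (f x)" if x: "x \<in> univ M" for x
  proof -
    obtain e where "e * e = e" "act M e x = x" "\<And>s t. act M s x = act M t x \<Longrightarrow> s * e = t * e"
      using reg[OF x] unfolding act_regular_iff[OF M_act x] by blast
    moreover have "act N s (f x) = act N t (f x) \<longleftrightarrow> act M s x = act M t x" for s t
      using inj_on_eq_iff[OF inj closed closed] x by (simp add: act)
    ultimately show ?thesis
      using act_regular_iff[OF N_act, of "f x"] x unfolding univ by (metis act imageI)
  qed
  then show ?thesis
    using N_act unfolding regular_act_def univ by blast
qed

text \<open>
  A copy of \<open>M\<close> inside \<open>'u\<close> belongs to the class, so the complete theory of \<open>M\<close> contains the theory
  of the class.  A saturated model of that complete theory inherits the defect.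
\<close>

theorem defect_refutes_primitive_normality:
  fixes M :: "('s::monoid_mult, 'm) L_struct"
  assumes large: "large_universe TYPE('s) TYPE('u)" and M: "regular_act M"
    and small: "(UNIV :: 'm set) \<lesssim> (UNIV :: ('s + nat) set set)"
    and defect: "holds M (defect_fm a b) []"
  shows "\<not> class_primitive_normal (regular_acts :: ('s, 'u) L_struct set)"
proof
  assume normal: "class_primitive_normal (regular_acts :: ('s, 'u) L_struct set)"
  have struct: "is_struct M"
    using M unfolding regular_act_def is_act_def by simp
  obtain g :: "'m \<Rightarrow> 'u" where g: "inj g"
    using lepoll_trans[OF small large[unfolded large_universe_def]] unfolding lepoll_def by blast
  define M' where "M' = \<lparr>univ = g ` univ M, act = (\<lambda>s x. g (act M s (inv_into UNIV g x)))\<rparr>"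
  have M': "inj_on g (univ M)" "univ M' = g ` univ M"
      "\<And>s x. x \<in> univ M \<Longrightarrow> act M' s (g x) = g (act M s x)"
    using g unfolding M'_def by (auto intro: inj_on_subset)
  have "regular_act M'"
    using regular_act_isomorphic[OF M M'] .
  then have M'_class: "M' \<in> regular_acts"
    unfolding regular_acts_def by simp
  have M'_holds: "holds M' \<phi> [] = holds M \<phi> []" if "sentence \<phi>" for \<phi>
  proof -
    obtain x where "x \<in> univ M" using struct unfolding is_struct_def by blast
    then have "sat M' (g \<circ> (\<lambda>_. x)) \<phi> = sat M (\<lambda>_. x) \<phi>"
      by (intro sat_isomorphic[OF struct M'])
    then show ?thesis
      using holds_sentence[OF that, of M'] holds_sentence[OF that, of M] by metis
  qed
  obtain N :: "('s, 'u) L_struct" where N: "is_struct N" "saturated N"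
    and N_holds: "\<And>\<phi>. sentence \<phi> \<Longrightarrow> holds N \<phi> [] = holds M \<phi> []"
    using saturated_elementarily_equivalent[OF large struct] by metis
  define T where "T = {\<phi>. sentence \<phi> \<and> holds N \<phi> []}"
  have model: "is_model N T"
    using N(1) unfolding is_model_def T_def by simp
  have "complete_theory TYPE('u) T"
    unfolding complete_theory_def
  proof (intro conjI allI impI ballI)
    show "\<exists>N :: ('s, 'u) L_struct. is_model N T" using model by blast
    show "\<phi> \<in> T \<or> Neg \<phi> \<in> T" if "sentence \<phi>" for \<phi>
      using that unfolding T_def sentence_def holds_def by simp
  qed (simp add: T_def)
  moreover have "theory_of (regular_acts :: ('s, 'u) L_struct set) \<subseteq> T"
    using M'_class M'_holds N_holds unfolding theory_of_def T_def by auto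
  ultimately have "primitive_normal TYPE('u) T"
    using normal unfolding class_primitive_normal_def completion_def by blast
  moreover have "monster T N"
    using model N(2) unfolding monster_def by simp
  ultimately have disjoint: "def_set N n \<phi> c = def_set N n \<phi> d \<or> def_set N n \<phi> c \<inter> def_set N n \<phi> d = {}"
    if "primitive \<phi>" "fv \<phi> \<subseteq> {..<n + m}" "c \<in> tuples N m" "d \<in> tuples N m" for n m \<phi> c d
    using that unfolding primitive_normal_def by blast
  have "holds N (defect_fm a b) []"
    using defect N_holds[OF sentence_defect_fm] by simp
  then show False
    by (rule defect_not_primitive_normal) (use disjoint in blast)
qed

text \<open>
  The three corners are \<open>(a p, b p)\<close>, \<open>(a q, b q)\<close>, \<open>(a r, b r)\<close>; the hypotheses identify the
  left entries of the first two and the right entries of the first and the last.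
\<close>

lemma holds_defect_fmI:
  assumes M: "is_struct M" and pqr: "p \<in> univ M" "q \<in> univ M" "r \<in> univ M"
    and eq: "act M a p = act M a q" "act M b p = act M b r"
    and none: "\<And>z. \<lbrakk>z \<in> univ M; act M a z = act M a r; act M b z = act M b q\<rbrakk> \<Longrightarrow> False"
  shows "holds M (defect_fm a b) []"
proof -
  have closed: "act M s x \<in> univ M" if "x \<in> univ M" for s x
    using M that unfolding is_struct_def by blast
  have link: "linked M a b (act M a z) (act M b z)" if "z \<in> univ M" for z
    using that unfolding linked_def by blast
  have "linked M a b (act M a p) (act M b p)"
    using link[OF pqr(1)] .
  moreover have "linked M a b (act M a p) (act M b q)"
    using link[OF pqr(2)] unfolding eq(1) .
  moreover have "linked M a b (act M a r) (act M b p)"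
    using link[OF pqr(3)] unfolding eq(2) .
  moreover have "\<not> linked M a b (act M a r) (act M b q)"
    using none unfolding linked_def by blast
  ultimately show ?thesis
    unfolding holds_defect_fm
    by (intro bexI[of _ "act M a p"] bexI[of _ "act M a r"] bexI[of _ "act M b p"]
        bexI[of _ "act M b q"] conjI closed pqr)
qed

section \<open>Incomparable elements of the regular part\<close>

text \<open>
  Three copies of \<open>S g\<close>, numbered 0, 1, 2.  Copy 1 is glued to copy 0 along \<open>S a\<close> and copy 2 along
  \<open>S b\<close>.  Each element is stored in normal form, moved to copy 0 whenever it lies in the glued part.
\<close>

definition glued_copy :: "'s::comm_monoid_mult \<Rightarrow> 's \<Rightarrow> nat \<Rightarrow> 's \<Rightarrow> nat \<times> 's" where
  "glued_copy a b k s = (if k = 1 \<and> a dvd s \<or> k = 2 \<and> b dvd s then 0 else k, s)"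

definition glued_act :: "'s::comm_monoid_mult \<Rightarrow> 's \<Rightarrow> 's \<Rightarrow> ('s, nat \<times> 's) L_struct" where
  "glued_act g a b = \<lparr>univ = {glued_copy a b k s | k s. k < 3 \<and> g dvd s},
     act = (\<lambda>t (k, s). glued_copy a b k (t * s))\<rparr>"

lemma act_glued_copy: "act (glued_act g a b) t (glued_copy a b k s) = glued_copy a b k (t * s)"
  unfolding glued_act_def glued_copy_def by auto

lemma glued_copy_in_univ: "k < 3 \<Longrightarrow> g dvd s \<Longrightarrow> glued_copy a b k s \<in> univ (glued_act g a b)"
  unfolding glued_act_def by auto

lemma glued_act_cases:
  assumes "x \<in> univ (glued_act g a b)"
  obtains k s where "x = glued_copy a b k s" "k < 3" "g dvd s"
  using assms unfolding glued_act_def by auto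

text \<open>
  Gluing does not identify two elements of the same copy, so each cyclic subact is isomorphic to one
  of \<open>S g\<close>.
\<close>

lemma regular_glued_act:
  fixes g :: "'s::comm_monoid_mult"
  assumes "g \<in> regular_part"
  shows "regular_act (glued_act g a b)"
proof -
  have "is_struct (glued_act g a b)"
    unfolding is_struct_def
  proof (intro conjI allI ballI)
    show "univ (glued_act g a b) \<noteq> {}"
      using glued_copy_in_univ[of 0 g g] by auto
    show "act (glued_act g a b) t x \<in> univ (glued_act g a b)" if "x \<in> univ (glued_act g a b)" for t x
      using that by (rule glued_act_cases) (auto simp: act_glued_copy intro!: glued_copy_in_univ)
  qed
  then have act: "is_act (glued_act g a b)"
    unfolding is_act_def by (auto elim!: glued_act_cases simp: act_glued_copy mult.assoc)
  have "act_regular (glued_act g a b) x" if x: "x \<in> univ (glued_act g a b)" for x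
  proof -
    obtain k u where x_eq: "x = glued_copy a b k (g * u)"
      using x by (rule glued_act_cases) (auto elim: dvdE)
    have "act_regular monoid_act (u * g)"
      using assms unfolding regular_part_iff by blast
    then obtain e where e: "e * e = e" "e * (g * u) = g * u"
        and eq: "\<And>s t. s * (g * u) = t * (g * u) \<Longrightarrow> s * e = t * e"
      unfolding act_regular_monoid_act_iff mult.commute[of u g] by blast
    have "s * e = t * e" if "act (glued_act g a b) s x = act (glued_act g a b) t x" for s t
      using that unfolding x_eq act_glued_copy by (intro eq) (simp add: glued_copy_def)
    moreover have "act (glued_act g a b) e x = x"
      unfolding x_eq act_glued_copy e(2) ..
    ultimately show ?thesis
      unfolding act_regular_iff[OF act x] using e(1) by blast
  qed
  then show ?thesis
    using act unfolding regular_act_def by blast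
qed

text \<open>
  The elements \<open>p, q, r\<close> are the generators of the copies 0, 1, 2.  Since \<open>b\<close> does not divide \<open>a\<close>, the element
  \<open>a r\<close> lies in copy 2 only, and symmetrically \<open>b q\<close> lies in copy 1 only; no single \<open>z\<close> reaches both.
\<close>

lemma glued_act_defect:
  fixes a b g :: "'s::comm_monoid_mult"
  assumes g: "g \<in> regular_part" "g * a = a" "g * b = b"
    and inc: "\<not> a dvd b" "\<not> b dvd a"
  shows "holds (glued_act g a b) (defect_fm a b) []"
proof (rule holds_defect_fmI)
  let ?M = "glued_act g a b"
  have ag: "a * g = a" "b * g = b" using g by (simp_all add: mult.commute)
  show "is_struct ?M"
    using regular_glued_act[OF g(1)] unfolding regular_act_def is_act_def by blast
  show "glued_copy a b 0 g \<in> univ ?M" "glued_copy a b 1 g \<in> univ ?M" "glued_copy a b 2 g \<in> univ ?M"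
    by (auto intro!: glued_copy_in_univ)
  show "act ?M a (glued_copy a b 0 g) = act ?M a (glued_copy a b 1 g)"
      "act ?M b (glued_copy a b 0 g) = act ?M b (glued_copy a b 2 g)"
    unfolding act_glued_copy ag by (simp_all add: glued_copy_def)
  fix z
  assume "z \<in> univ ?M" and z: "act ?M a z = act ?M a (glued_copy a b 2 g)"
      "act ?M b z = act ?M b (glued_copy a b 1 g)"
  from this(1) obtain k s where z_eq: "z = glued_copy a b k s"
    by (rule glued_act_cases)
  show False
    using z inc unfolding z_eq act_glued_copy ag by (simp add: glued_copy_def split: if_splits)
qed

text \<open>
  Here \<open>p, q, r\<close> are \<open>e g\<close>, \<open>g\<close>, \<open>e\<close>.  An element \<open>z\<close> with \<open>e z = e\<close> and \<open>g z = g\<close> would be a common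
  upper bound of the two idempotents, which a multiple of \<open>e\<close> or of \<open>g\<close> cannot be.
\<close>

lemma union_of_idempotents_defect:
  fixes e g :: "'s::comm_monoid_mult"
  assumes R: "e \<in> regular_part" "g \<in> regular_part" and idem: "e * e = e" "g * g = g"
    and inc: "e * g \<noteq> e" "e * g \<noteq> g"
  defines "M \<equiv> (monoid_act :: ('s, 's) L_struct)\<lparr>univ := {s. e dvd s \<or> g dvd s}\<rparr>"
  shows "regular_act M" "holds M (defect_fm e g) []"
proof -
  have reg: "act_regular monoid_act s" if "h \<in> regular_part" "h dvd s" for h s :: 's
  proof -
    obtain u where "s = h * u"
      using \<open>h dvd s\<close> by (rule dvdE)
    then show ?thesis
      using \<open>h \<in> regular_part\<close> unfolding regular_part_iff by (simp add: mult.commute[of h u])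
  qed
  show M: "regular_act M"
    unfolding M_def regular_act_monoid_subset_iff
  proof (intro conjI allI ballI)
    have "e \<in> {s. e dvd s \<or> g dvd s}"
      by simp
    then show "{s. e dvd s \<or> g dvd s} \<noteq> {}"
      by blast
    fix s t assume s: "s \<in> {s. e dvd s \<or> g dvd s}"
    then show "t * s \<in> {s. e dvd s \<or> g dvd s}"
      by (auto intro: dvd_mult)
    show "act_regular monoid_act s"
      using s reg[OF R(1), of s] reg[OF R(2), of s] by blast
  qed
  show "holds M (defect_fm e g) []"
  proof (rule holds_defect_fmI)
    show "is_struct M" using M unfolding regular_act_def is_act_def by blast
    show "e * g \<in> univ M" "g \<in> univ M" "e \<in> univ M"
      unfolding M_def by auto
    show "act M e (e * g) = act M e g"
      unfolding M_def monoid_act_def by (simp add: mult.assoc[symmetric] idem)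
    show "act M g (e * g) = act M g e"
      unfolding M_def monoid_act_def by (simp add: mult.left_commute[of g e g] idem mult.commute)
    fix z assume "z \<in> univ M" "act M e z = act M e e" "act M g z = act M g g"
    then have z: "e dvd z \<or> g dvd z" "e * z = e" "g * z = g"
      unfolding M_def monoid_act_def using idem by simp_all
    from z(1) show False
    proof
      assume "e dvd z"
      then obtain u where "z = e * u" by (rule dvdE)
      then have "e * z = z" by (simp add: mult.assoc[symmetric] idem)
      then have "g * e = g" using z by simp
      then show False using inc by (simp add: mult.commute)
    next
      assume "g dvd z"
      then obtain u where "z = g * u" by (rule dvdE)
      then have "g * z = z" by (simp add: mult.assoc[symmetric] idem)
      then have "e * g = e" using z by simp
      then show False using inc by simp
    qed
  qed
qed

text \<open>
  If the idempotents of \<open>a\<close> and \<open>b\<close> are comparable, the larger one fixes both elements and the glued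
  act applies; otherwise the union of the two cyclic subacts generated by the idempotents does.
\<close>

lemma primitive_normal_imp_linearly_ordered:
  assumes large: "large_universe TYPE('s::comm_monoid_mult) TYPE('u)"
    and normal: "class_primitive_normal (regular_acts :: ('s, 'u) L_struct set)"
  shows "linearly_ordered (regular_part :: 's set)"
proof (rule ccontr)
  assume "\<not> linearly_ordered (regular_part :: 's set)"
  then obtain a b :: 's where R: "a \<in> regular_part" "b \<in> regular_part"
    and sub: "\<not> (\<lambda>t. t * a) ` regular_part \<subseteq> (\<lambda>t. t * b) ` regular_part"
      "\<not> (\<lambda>t. t * b) ` regular_part \<subseteq> (\<lambda>t. t * a) ` regular_part"
    unfolding linearly_ordered_def by blast
  have "(\<lambda>t. t * a) ` regular_part \<subseteq> (\<lambda>t. t * b) ` regular_part" if "b dvd a" for a b :: 's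
  proof
    fix x assume "x \<in> (\<lambda>t. t * a) ` regular_part"
    then obtain t where t: "t \<in> regular_part" "x = t * a" by blast
    obtain u where "a = b * u" using \<open>b dvd a\<close> by (rule dvdE)
    then have "x = (u * t) * b" using t by (simp add: mult_ac)
    then show "x \<in> (\<lambda>t. t * b) ` regular_part"
      using regular_part_left_ideal[OF t(1)] by blast
  qed
  then have inc: "\<not> a dvd b" "\<not> b dvd a"
    using sub by blast+
  have small: "(UNIV :: (nat \<times> 's) set) \<lesssim> (UNIV :: ('s + nat) set set)"
    "(UNIV :: 's set) \<lesssim> (UNIV :: ('s + nat) set set)"
  proof -
    have "inj (\<lambda>(k :: nat, s :: 's). {Inl s, Inr k})"
      unfolding inj_def by (auto simp: doubleton_eq_iff)
    then show "(UNIV :: (nat \<times> 's) set) \<lesssim> (UNIV :: ('s + nat) set set)"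
      unfolding lepoll_def by blast
    have "inj (\<lambda>s :: 's. {Inl s :: 's + nat})"
      unfolding inj_def by auto
    then show "(UNIV :: 's set) \<lesssim> (UNIV :: ('s + nat) set set)"
      unfolding lepoll_def by blast
  qed
  have no_common: False if "h \<in> regular_part" "h * a = a" "h * b = b" for h
    using defect_refutes_primitive_normality[OF large regular_glued_act[OF that(1)] small(1)
        glued_act_defect[OF that inc]] normal
    by contradiction
  obtain e where e: "e \<in> regular_part" "e * e = e" "e * a = a"
    using regular_part_idempotent[OF R(1)] by blast
  obtain g where g: "g \<in> regular_part" "g * g = g" "g * b = b"
    using regular_part_idempotent[OF R(2)] by blast
  have "e * g \<noteq> e"
  proof
    assume "e * g = e"
    then have "g * e = e" by (simp add: mult.commute)
    then have "g * a = a" using e(3) by (metis mult.assoc)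
    then show False using no_common g by blast
  qed
  moreover have "e * g \<noteq> g"
  proof
    assume "e * g = g"
    then have "e * b = b" using g(3) by (metis mult.assoc)
    then show False using no_common e by blast
  qed
  ultimately have "\<not> class_primitive_normal (regular_acts :: ('s, 'u) L_struct set)"
    using defect_refutes_primitive_normality[OF large _ small(2)]
      union_of_idempotents_defect[OF e(1) g(1) e(2) g(2)] by blast
  with normal show False by contradiction
qed

section \<open>The equivalence\<close>

text \<open>
  Axiomatizability enters here: the axioms belong to the theory of the class, so the saturated
  models of its completions are themselves regular acts, on which the Pixley operation exists.
\<close>

lemma linearly_ordered_imp_antiadditive:
  assumes lin: "linearly_ordered (regular_part :: 's::comm_monoid_mult set)"
    and ax: "axiomatizable (regular_acts :: ('s, 'u) L_struct set)"
  shows "class_antiadditive (regular_acts :: ('s, 'u) L_struct set)"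
  unfolding class_antiadditive_def
proof (intro allI impI)
  fix T :: "'s fm set"
  assume T: "completion TYPE('u) (theory_of (regular_acts :: ('s, 'u) L_struct set)) T"
  obtain \<Sigma> where \<Sigma>: "\<forall>\<phi>\<in>\<Sigma>. sentence \<phi>" "(regular_acts :: ('s, 'u) L_struct set) = {M. is_model M \<Sigma>}"
    using ax unfolding axiomatizable_def by blast
  have "\<Sigma> \<subseteq> theory_of (regular_acts :: ('s, 'u) L_struct set)"
    unfolding theory_of_def \<Sigma>(2) using \<Sigma>(1) by (auto simp: is_model_def)
  also have "\<dots> \<subseteq> T"
    using T unfolding completion_def by blast
  finally have sub: "\<Sigma> \<subseteq> T" .
  have regular: "regular_act C" if "monster T C" for C :: "('s, 'u) L_struct"
  proof -
    have "is_model C \<Sigma>"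
      using that sub unfolding monster_def is_model_def by blast
    then have "C \<in> regular_acts" unfolding \<Sigma>(2) by simp
    then show ?thesis unfolding regular_acts_def by simp
  qed
  show "antiadditive TYPE('u) T"
    unfolding antiadditive_def
  proof (intro conjI allI impI notI)
    show "primitive_normal TYPE('u) T"
      unfolding primitive_normal_def
      using regular_act_primitive_normal[OF lin regular] by blast
    fix C :: "('s, 'u) L_struct"
    assume C: "monster T C"
    assume "\<exists>n X \<alpha> add z. gen_primitive_rep C n X \<alpha> \<and> infinite (X // \<alpha>) \<and>
      primitive_operation C n X \<alpha> add \<and> comm_group \<lparr>carrier = X // \<alpha>, mult = add, one = z\<rparr>"
    then obtain n X \<alpha> add z where rep: "gen_primitive_rep C n X \<alpha>" and inf: "infinite (X // \<alpha>)"
      and op: "primitive_operation C n X \<alpha> add"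
      and G: "comm_group \<lparr>carrier = X // \<alpha>, mult = add, one = z\<rparr>"
      by blast
    have "X \<subseteq> tuples C n"
      using rep unfolding gen_primitive_rep_def Delta_primitive_set_def primitive_set_def def_set_def
      by blast
    then have "X // \<alpha> = {z}"
      by (rule regular_act_primitive_group_trivial[OF lin regular[OF C] _ op G])
    with inf show False by simp
  qed
qed

theorem corollary3p7:
  assumes "large_universe TYPE('s::comm_monoid_mult) TYPE('u)"
    and "(regular_part :: 's set) \<noteq> {}"
    and "axiomatizable (regular_acts :: ('s, 'u) L_struct set)"
  shows "(class_primitive_normal (regular_acts :: ('s, 'u) L_struct set) \<longleftrightarrow>
            class_antiadditive (regular_acts :: ('s, 'u) L_struct set)) \<and>
         (class_antiadditive (regular_acts :: ('s, 'u) L_struct set) \<longleftrightarrow>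
            linearly_ordered (regular_part :: 's set))"
proof -
  have "class_antiadditive (regular_acts :: ('s, 'u) L_struct set) \<Longrightarrow>
      class_primitive_normal (regular_acts :: ('s, 'u) L_struct set)"
    unfolding class_antiadditive_def class_primitive_normal_def antiadditive_def by blast
  then show ?thesis
    using primitive_normal_imp_linearly_ordered[OF assms(1)]
      linearly_ordered_imp_antiadditive[OF _ assms(3)] by blast
qed

end
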